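(* Let $H$ be a Hilbert space, let $A\subseteq\mathcal{B}(H)$ be a C$^*$-algebra, take $P_0,\ldots,P_n\in\mathcal{P}(A)$ and set $T=P_0P_1\cdots P_n$ and $P=P_0\wedge\ldots\wedge P_n$. If $R$ is a projection on $H$ with $R\leq P$ and $\|T-R\|<1$ then $R=P$. Moreover, assuming $A$ has real rank zero and $\mathcal{P}(A)$ is $\sigma$-closed, if $R\in\mathcal{P}(A)$ is the greatest lower bound of $P_0,\ldots,P_n$ in $\mathcal{P}(A)$ then $\|T-R\|<1$.
   Context: Hilbert spaces and C$^*$-algebras are over $\mathbb{F}=\mathbb{R}$ or $\mathbb{C}$. $\mathcal{P}(A)$ is the set of projections (self-adjoint idempotents) of $A$, ordered by $P\leq Q\Leftrightarrow PQ=P$. $P_0\wedge\ldots\wedge P_n$ denotes the greatest lower bound in $\mathcal{P}(\mathcal{B}(H))$, i.e. the projection onto $\bigcap_k\mathcal{R}(P_k)$ (where $\mathcal{R}$ denotes range). $A$ has real rank zero if the invertible self-adjoint elements are dense in the self-adjoint elements of $A$ (of $A$ with a unit adjoined, if $A$ has none). A partially ordered set with minimum $0$ is $\sigma$-closed if every decreasing sequence of non-zero elements has a non-zero lower bound in it. *)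

theory Defs
  imports "HOL-Analysis.Analysis"
begin

text \<open>
  The axioms force such a field to be the reals with trivial conjugation or the complex
  numbers with the usual one: see \<open>real_or_complex_cases\<close> below.
\<close>

class real_or_complex = real_normed_field +
  fixes conjg :: "'a \<Rightarrow> 'a"
  assumes conjg_add: "conjg (x + y) = conjg x + conjg y"
    and conjg_mult: "conjg (x * y) = conjg x * conjg y"
    and conjg_scaleR_one: "conjg (r *\<^sub>R 1) = r *\<^sub>R 1"
    and mult_conjg_scaleR: "x * conjg x = ((norm x)\<^sup>2) *\<^sub>R 1"

instantiation real :: real_or_complex
begin
definition conjg_real :: "real \<Rightarrow> real" where "conjg_real x = x"
instance by standard (simp_all add: conjg_real_def power2_eq_square)
end

instantiation complex :: real_or_complex
begin
definition conjg_complex :: "complex \<Rightarrow> complex" where "conjg_complex = cnj"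
instance
  by standard
    (simp_all add: conjg_complex_def scaleR_conv_of_real complex_norm_square flip: of_real_power)
end

lemma conjg_of_real: "conjg (of_real r :: 'f::real_or_complex) = of_real r"
  by (simp add: of_real_def conjg_scaleR_one)

lemma mult_conjg: "x * conjg x = of_real ((norm (x :: 'f::real_or_complex))\<^sup>2)"
  by (simp only: of_real_def mult_conjg_scaleR)

lemma conjg_conjg: "conjg (conjg x) = (x :: 'f::real_or_complex)"
proof (cases "x = 0")
  case True
  then show ?thesis using conjg_of_real[of 0, where ?'f='f] by simp
next
  case False
  then have "conjg x \<noteq> 0" using mult_conjg[of x] by auto
  moreover have "conjg x * conjg (conjg x) = conjg x * x"
    by (metis conjg_mult conjg_of_real mult_conjg mult.commute)
  ultimately show ?thesis by simp
qed

lemma conjg_minus: "conjg (- x) = - conjg (x :: 'f::real_or_complex)"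
  by (metis conjg_mult conjg_of_real mult_minus1 of_real_1 of_real_minus)

lemma conjg_diff: "conjg (x - y) = conjg x - conjg (y :: 'f::real_or_complex)"
  using conjg_add[of x "- y"] by (simp add: conjg_minus)

lemma conjg_fixed_real:
  assumes "conjg x = (x :: 'f::real_or_complex)"
  shows "x \<in> range of_real"
proof -
  have "x * x = of_real (norm x) * of_real (norm x)"
    using mult_conjg[of x] assms by (simp add: power2_eq_square)
  then have "x = of_real (norm x) \<or> x = of_real (- norm x)"
    by (simp add: square_eq_iff)
  then show ?thesis by blast
qed

lemma real_or_complex_cases:
  "(\<forall>x::'f::real_or_complex. x \<in> range of_real) \<or>
   (\<exists>i::'f. i * i = - 1 \<and> conjg i = - i \<and> (\<forall>x. \<exists>a b. x = of_real a + of_real b * i))"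
proof (cases "\<forall>x::'f. x \<in> range of_real")
  case False
  then obtain z :: 'f where z: "conjg z \<noteq> z" using conjg_fixed_real by blast
  define d where "d = z - conjg z"
  have d: "conjg d = - d" "d \<noteq> 0"
    using z by (auto simp: d_def conjg_diff conjg_conjg)
  define i where "i = of_real (1 / norm d) * d"
  have i: "conjg i = - i" by (simp only: i_def conjg_mult conjg_of_real d mult_minus_right)
  have "norm i = 1" using d(2) by (simp add: i_def norm_divide)
  then have ii: "i * i = - 1" using mult_conjg[of i] i by (simp add: minus_equation_iff)
  have "\<exists>a b. x = of_real a + of_real b * i" for x :: 'f
  proof -
    have "conjg (x + conjg x) = x + conjg x" by (simp add: conjg_add conjg_conjg)
    then obtain a where a: "x + conjg x = of_real a" using conjg_fixed_real by blast
    have "conjg ((x - conjg x) * i) = (x - conjg x) * i"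
      by (simp add: conjg_mult conjg_diff conjg_conjg i flip: mult_minus_left)
    then obtain b where b: "(x - conjg x) * i = of_real b" using conjg_fixed_real by blast
    have "x - conjg x = - (((x - conjg x) * i) * i)" by (simp add: mult.assoc ii)
    then have c: "x - conjg x = - of_real b * i" using b by simp
    have "2 * x = (x + conjg x) + (x - conjg x)" by simp
    also have "\<dots> = of_real a - of_real b * i" using a c by simp
    finally have "x = of_real (a / 2) + of_real (- b / 2) * i"
      by (simp add: field_simps)
    then show ?thesis by blast
  qed
  with i ii show ?thesis by blast
qed simp

text \<open>
  The type \<open>'h\<close> supplies the addition, the norm and its completeness, and hence, through
  \<open>'h \<Rightarrow>\<^sub>L 'h\<close>, the operators with their norm and composition. The \<open>'f\<close>-scalar multiplication and
  the \<open>'f\<close>-valued inner product are tied to these by \<open>scale_of_real\<close> and \<open>ip_self\<close>; by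
  polarization the class inner product is the real part of \<open>ip\<close>.
\<close>

locale hilbert_space = vector_space sc
  for sc :: "'f::real_or_complex \<Rightarrow> 'h::{real_inner, complete_space} \<Rightarrow> 'h" +
  fixes ip :: "'h \<Rightarrow> 'h \<Rightarrow> 'f"
  assumes scale_of_real: "sc (of_real r) x = r *\<^sub>R x"
    and ip_add_left: "ip (x + y) z = ip x z + ip y z"
    and ip_scale_left: "ip (sc c x) y = c * ip x y"
    and ip_conjg: "ip y x = conjg (ip x y)"
    and ip_self: "ip x x = of_real ((norm x)\<^sup>2)"

lemma hilbert_space_real:
  "hilbert_space (scaleR :: real \<Rightarrow> 'h \<Rightarrow> 'h::{real_inner, complete_space}) inner"
  by unfold_locales
     (simp_all add: conjg_real_def inner_add_left inner_commute power2_norm_eq_inner algebra_simps)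

lemma hilbert_space_complex:
  "hilbert_space ((*) :: complex \<Rightarrow> complex \<Rightarrow> complex) (\<lambda>x y. x * cnj y)"
  by unfold_locales
     (simp_all add: conjg_complex_def algebra_simps complex_norm_square scaleR_conv_of_real
        flip: complex_norm_square)

definition bounded_ops ::
  "('f::real_or_complex \<Rightarrow> 'h::{real_inner, complete_space} \<Rightarrow> 'h) \<Rightarrow> ('h \<Rightarrow>\<^sub>L 'h) set" where
  "bounded_ops sc = {a. \<forall>c x. blinfun_apply a (sc c x) = sc c (blinfun_apply a x)}"

definition is_adjoint ::
  "('h \<Rightarrow> 'h \<Rightarrow> 'f::real_or_complex) \<Rightarrow> ('h::{real_inner, complete_space} \<Rightarrow>\<^sub>L 'h)
    \<Rightarrow> ('h \<Rightarrow>\<^sub>L 'h) \<Rightarrow> bool" where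
  "is_adjoint ip a b \<longleftrightarrow> (\<forall>x y. ip (blinfun_apply a x) y = ip x (blinfun_apply b y))"

definition op_scale ::
  "('f::real_or_complex \<Rightarrow> 'h::{real_inner, complete_space} \<Rightarrow> 'h) \<Rightarrow> 'f
    \<Rightarrow> ('h \<Rightarrow>\<^sub>L 'h) \<Rightarrow> ('h \<Rightarrow>\<^sub>L 'h)" where
  "op_scale sc c a = Blinfun (\<lambda>x. sc c (blinfun_apply a x))"

lemma (in hilbert_space) norm_scale: "norm (sc c x) = norm c * norm x"
proof -
  have "ip x (sc c x) = conjg c * ip x x"
    by (metis ip_conjg ip_scale_left conjg_mult)
  then have "ip (sc c x) (sc c x) = c * conjg c * ip x x"
    by (simp add: ip_scale_left mult.assoc)
  then have "(of_real ((norm (sc c x))\<^sup>2) :: 'f) = of_real ((norm c * norm x)\<^sup>2)"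
    by (simp add: ip_self mult_conjg power_mult_distrib)
  then have "(norm (sc c x))\<^sup>2 = (norm c * norm x)\<^sup>2" by (simp only: of_real_eq_iff)
  then show ?thesis by (simp add: power2_eq_iff_nonneg)
qed

lemma (in hilbert_space) op_scale_apply:
  "blinfun_apply (op_scale sc c a) x = sc c (blinfun_apply a x)"
proof -
  have "sc c (r *\<^sub>R y) = r *\<^sub>R sc c y" for r y
    by (metis mult.commute scale_of_real scale_scale)
  then have "bounded_linear (sc c)"
    by (intro bounded_linear_intro[where K = "norm c"])
       (simp_all add: scale_right_distrib norm_scale)
  then have "bounded_linear (\<lambda>x. sc c (blinfun_apply a x))"
    by (rule bounded_linear_compose[OF _ blinfun.bounded_linear_right])
  then show ?thesis by (simp add: op_scale_def bounded_linear_Blinfun_apply)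
qed

definition cstar_algebra ::
  "('f::real_or_complex \<Rightarrow> 'h::{real_inner, complete_space} \<Rightarrow> 'h) \<Rightarrow> ('h \<Rightarrow> 'h \<Rightarrow> 'f)
    \<Rightarrow> ('h \<Rightarrow>\<^sub>L 'h) set \<Rightarrow> bool" where
  "cstar_algebra sc ip A \<longleftrightarrow>
     A \<subseteq> bounded_ops sc \<and> 0 \<in> A \<and>
     (\<forall>a\<in>A. \<forall>b\<in>A. a + b \<in> A) \<and>
     (\<forall>c. \<forall>a\<in>A. op_scale sc c a \<in> A) \<and>
     (\<forall>a\<in>A. \<forall>b\<in>A. a o\<^sub>L b \<in> A) \<and>
     (\<forall>a\<in>A. \<exists>b\<in>A. is_adjoint ip a b) \<and>
     closed A"

text \<open>A unit of \<open>A\<close> need not be the identity operator.\<close>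

definition unit_of :: "('h::{real_inner, complete_space} \<Rightarrow>\<^sub>L 'h) set \<Rightarrow> ('h \<Rightarrow>\<^sub>L 'h) \<Rightarrow> bool" where
  "unit_of A e \<longleftrightarrow> e \<in> A \<and> (\<forall>a\<in>A. e o\<^sub>L a = a \<and> a o\<^sub>L e = a)"

definition invertible_in ::
  "('h::{real_inner, complete_space} \<Rightarrow>\<^sub>L 'h) set \<Rightarrow> ('h \<Rightarrow>\<^sub>L 'h) \<Rightarrow> bool" where
  "invertible_in A a \<longleftrightarrow> a \<in> A \<and> (\<exists>e. unit_of A e \<and> (\<exists>b\<in>A. a o\<^sub>L b = e \<and> b o\<^sub>L a = e))"

text \<open>
  If \<open>A\<close> has no unit then it does not contain the identity operator, so the algebra with a unit
  adjoined is realized on the same Hilbert space by adding the scalar multiples of the identity.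
\<close>

definition unitization ::
  "('f::real_or_complex \<Rightarrow> 'h::{real_inner, complete_space} \<Rightarrow> 'h)
    \<Rightarrow> ('h \<Rightarrow>\<^sub>L 'h) set \<Rightarrow> ('h \<Rightarrow>\<^sub>L 'h) set" where
  "unitization sc A =
     (if \<exists>e. unit_of A e then A else {a + op_scale sc c id_blinfun |a c. a \<in> A})"

definition real_rank_zero ::
  "('f::real_or_complex \<Rightarrow> 'h::{real_inner, complete_space} \<Rightarrow> 'h) \<Rightarrow> ('h \<Rightarrow> 'h \<Rightarrow> 'f)
    \<Rightarrow> ('h \<Rightarrow>\<^sub>L 'h) set \<Rightarrow> bool" where
  "real_rank_zero sc ip A \<longleftrightarrow>
     (let B = unitization sc A in
      {a \<in> B. is_adjoint ip a a} \<subseteq> closure {a \<in> B. is_adjoint ip a a \<and> invertible_in B a})"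

definition projections ::
  "('h \<Rightarrow> 'h \<Rightarrow> 'f::real_or_complex) \<Rightarrow> ('h::{real_inner, complete_space} \<Rightarrow>\<^sub>L 'h) set
    \<Rightarrow> ('h \<Rightarrow>\<^sub>L 'h) set" where
  "projections ip A = {p \<in> A. is_adjoint ip p p \<and> p o\<^sub>L p = p}"

definition proj_le ::
  "('h::{real_inner, complete_space} \<Rightarrow>\<^sub>L 'h) \<Rightarrow> ('h \<Rightarrow>\<^sub>L 'h) \<Rightarrow> bool" where
  "proj_le p q \<longleftrightarrow> p o\<^sub>L q = p"

definition is_glb_in :: "('a \<Rightarrow> 'a \<Rightarrow> bool) \<Rightarrow> 'a set \<Rightarrow> 'a set \<Rightarrow> 'a \<Rightarrow> bool" where
  "is_glb_in le S X m \<longleftrightarrow>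
     m \<in> S \<and> (\<forall>x\<in>X. le m x) \<and> (\<forall>l\<in>S. (\<forall>x\<in>X. le l x) \<longrightarrow> le l m)"

definition sigma_closed :: "('a \<Rightarrow> 'a \<Rightarrow> bool) \<Rightarrow> 'a \<Rightarrow> 'a set \<Rightarrow> bool" where
  "sigma_closed le z S \<longleftrightarrow>
     (\<forall>p :: nat \<Rightarrow> 'a. (\<forall>k. p k \<in> S \<and> p k \<noteq> z \<and> le (p (Suc k)) (p k)) \<longrightarrow>
        (\<exists>q\<in>S. q \<noteq> z \<and> (\<forall>k. le q (p k))))"

definition proj_meet ::
  "('f::real_or_complex \<Rightarrow> 'h::{real_inner, complete_space} \<Rightarrow> 'h) \<Rightarrow> ('h \<Rightarrow> 'h \<Rightarrow> 'f)
    \<Rightarrow> ('h \<Rightarrow>\<^sub>L 'h) set \<Rightarrow> ('h \<Rightarrow>\<^sub>L 'h)" where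
  "proj_meet sc ip X =
     (THE p. is_glb_in proj_le (projections ip (bounded_ops sc)) X p)"

text \<open>\<open>op_prod p n\<close> is the composition \<open>p 0 o\<^sub>L p 1 o\<^sub>L \<dots> o\<^sub>L p n\<close>.\<close>

primrec op_prod ::
  "(nat \<Rightarrow> 'h::{real_inner, complete_space} \<Rightarrow>\<^sub>L 'h) \<Rightarrow> nat \<Rightarrow> 'h \<Rightarrow>\<^sub>L 'h" where
  "op_prod p 0 = p 0"
| "op_prod p (Suc n) = op_prod p n o\<^sub>L p (Suc n)"

end

theory Submission
  imports Defs
begin

text \<open>
  If \<open>R \<le> P\<close>, then \<open>T - R\<close> is the identity on the range of \<open>P - R\<close>, which gives the first claim.

  For the second, replace each \<open>P\<^sub>k\<close> by \<open>P\<^sub>k - R\<close>; this replaces \<open>T\<close> by \<open>T - R\<close> and the greatest lower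
  bound by \<open>0\<close>. If \<open>T\<close> then had norm \<open>1\<close>, the operator \<open>S = T\<^sup>* T\<close> would have approximate eigenvectors
  for the eigenvalue \<open>1\<close>. Real rank zero makes \<open>S - \<lambda>\<close> close to an invertible self-adjoint operator
  \<open>b\<close>, whose positive spectral projection, slightly rotated, contains all these approximate
  eigenvectors. Iterating with \<open>\<lambda> \<longlongrightarrow> 1\<close> yields a decreasing sequence of non-zero projections \<open>r\<^sub>k\<close> of \<open>A\<close>
  with \<open>(1 - S) r\<^sub>k\<close> tending to \<open>0\<close>, and a non-zero lower bound of it consists of vectors fixed by
  \<open>S\<close>, hence by every \<open>P\<^sub>k\<close>, a contradiction.

  Apart from the projection onto the common fixed points, which has to commute with the scalars,
  everything only involves the underlying real Hilbert space.
\<close>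

section \<open>Completeness of the space of bounded operators and Neumann series\<close>

lemma complete_UNIV_blinfun:
  "complete (UNIV :: ('a::real_normed_vector \<Rightarrow>\<^sub>L 'b::{real_normed_vector, complete_space}) set)"
proof (rule completeI)
  fix X :: "nat \<Rightarrow> 'a \<Rightarrow>\<^sub>L 'b"
  assume X: "Cauchy X"
  have "Cauchy (\<lambda>n. X n x)" for x
    by (rule bounded_linear.Cauchy[OF blinfun.bounded_linear_left X])
  then obtain F where F: "(\<lambda>n. X n x) \<longlonglongrightarrow> F x" for x
    unfolding Cauchy_convergent_iff convergent_def by metis
  have close: "\<exists>N. \<forall>n\<ge>N. \<forall>x. norm (X n x - F x) \<le> e * norm x" if e: "e > 0" for e
  proof -
    obtain N where N: "norm (X m - X n) < e" if "m \<ge> N" "n \<ge> N" for m n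
      using CauchyD[OF X e] by blast
    have "norm (X n x - F x) \<le> e * norm x" if "n \<ge> N" for n x
    proof (rule LIMSEQ_le_const2)
      show "(\<lambda>m. norm (X n x - X m x)) \<longlonglongrightarrow> norm (X n x - F x)"
        by (intro tendsto_intros F)
      have "norm (X n x - X m x) \<le> e * norm x" if "m \<ge> N" for m
      proof -
        have "norm (X n x - X m x) = norm ((X n - X m) x)" by (simp add: blinfun.diff_left)
        also have "\<dots> \<le> norm (X n - X m) * norm x" by (rule norm_blinfun)
        also have "\<dots> \<le> e * norm x"
          using N[OF \<open>n \<ge> N\<close> that] by (intro mult_right_mono) auto
        finally show ?thesis .
      qed
      then show "\<exists>k. \<forall>m\<ge>k. norm (X n x - X m x) \<le> e * norm x" by blast
    qed
    then show ?thesis by blast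
  qed
  obtain N where N: "norm (X N x - F x) \<le> 1 * norm x" for x
    using close[of 1] by auto
  have "bounded_linear F"
  proof (rule bounded_linear_intro)
    show "F (x + y) = F x + F y" for x y
      using F[of "x + y"] tendsto_add[OF F[of x] F[of y]]
      by (simp add: blinfun.add_right LIMSEQ_unique)
    show "F (r *\<^sub>R x) = r *\<^sub>R F x" for r x
      using F[of "r *\<^sub>R x"] tendsto_scaleR[OF tendsto_const[of r] F[of x]]
      by (simp add: blinfun.scaleR_right LIMSEQ_unique)
    show "norm (F x) \<le> norm x * (norm (X N) + 1)" for x
    proof -
      have "norm (F x) \<le> norm (X N x) + norm (X N x - F x)"
        using norm_triangle_ineq2[of "F x" "X N x"] by (simp add: norm_minus_commute)
      also have "\<dots> \<le> norm (X N) * norm x + 1 * norm x"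
        by (intro add_mono norm_blinfun N)
      finally show ?thesis by (simp add: algebra_simps)
    qed
  qed
  then have F_apply: "blinfun_apply (Blinfun F) = F" by (rule bounded_linear_Blinfun_apply)
  have "X \<longlonglongrightarrow> Blinfun F"
  proof (rule LIMSEQ_I)
    fix e :: real assume "e > 0"
    then obtain N where N: "\<And>n x. n \<ge> N \<Longrightarrow> norm (X n x - F x) \<le> (e / 2) * norm x"
      using close[of "e / 2"] by auto
    have "norm (X n - Blinfun F) \<le> e / 2" if "n \<ge> N" for n
      using N[OF that] \<open>e > 0\<close> by (intro norm_blinfun_bound) (auto simp: blinfun.diff_left F_apply)
    then show "\<exists>N. \<forall>n\<ge>N. norm (X n - Blinfun F) < e"
      using \<open>e > 0\<close> by (intro exI[of _ N]) (auto intro: le_less_trans[of _ "e / 2"])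
  qed
  then show "\<exists>l\<in>UNIV. X \<longlonglongrightarrow> l" by blast
qed

text \<open>Inverses and square roots are found below as Banach fixed points in a closed set of
  operators, so that membership in the algebra comes with the solution.\<close>

lemma complete_closed_blinfun:
  fixes D :: "('a::real_normed_vector \<Rightarrow>\<^sub>L 'b::{real_normed_vector, complete_space}) set"
  shows "closed D \<Longrightarrow> complete D"
  using complete_Int_closed[OF complete_UNIV_blinfun, of D] by simp

lemma continuous_on_blinfun_compose [continuous_intros]:
  assumes "continuous_on S f" "continuous_on S g"
  shows "continuous_on S (\<lambda>x. f x o\<^sub>L g x)"
  using bounded_bilinear.continuous_on[OF bounded_bilinear_blinfun_compose assms] .

lemma blinfun_compose_assoc: "(a o\<^sub>L b) o\<^sub>L c = a o\<^sub>L (b o\<^sub>L c)"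
  by (rule blinfun_eqI) simp

lemmas blinfun_compose_simps =
  bounded_bilinear.add_left[OF bounded_bilinear_blinfun_compose]
  bounded_bilinear.add_right[OF bounded_bilinear_blinfun_compose]
  bounded_bilinear.diff_left[OF bounded_bilinear_blinfun_compose]
  bounded_bilinear.diff_right[OF bounded_bilinear_blinfun_compose]
  bounded_bilinear.minus_left[OF bounded_bilinear_blinfun_compose]
  bounded_bilinear.minus_right[OF bounded_bilinear_blinfun_compose]
  bounded_bilinear.scaleR_left[OF bounded_bilinear_blinfun_compose]
  bounded_bilinear.scaleR_right[OF bounded_bilinear_blinfun_compose]
  blinfun_compose_assoc


text \<open>The solution is \<open>q (1 - u)\<^sup>-\<^sup>1\<close>; no unit in \<open>D\<close> is needed.\<close>

lemma neumann_right:
  fixes D :: "('h::{real_inner, complete_space} \<Rightarrow>\<^sub>L 'h) set" and u q :: "'h \<Rightarrow>\<^sub>L 'h"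
  assumes "closed D" "q \<in> D" "\<And>g. g \<in> D \<Longrightarrow> q + (g o\<^sub>L u) \<in> D" and u: "norm u < 1"
  obtains g where "g \<in> D" "g = q + (g o\<^sub>L u)"
proof -
  have "\<exists>!g\<in>D. q + (g o\<^sub>L u) = g"
  proof (rule Banach_fix[where c = "norm u"])
    show "complete D" by (rule complete_closed_blinfun) fact
    fix x y :: "'h \<Rightarrow>\<^sub>L 'h"
    have "norm ((x - y) o\<^sub>L u) \<le> norm (x - y) * norm u" by (rule norm_blinfun_compose)
    then show "dist (q + (x o\<^sub>L u)) (q + (y o\<^sub>L u)) \<le> norm u * dist x y"
      by (simp add: dist_norm blinfun_compose_simps mult.commute)
  qed (use assms in auto)
  then show ?thesis using that by metis
qed

section \<open>Adjoints with respect to the real inner product\<close>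

abbreviation self_adjoint :: "('h::{real_inner, complete_space} \<Rightarrow>\<^sub>L 'h) \<Rightarrow> bool" where
  "self_adjoint a \<equiv> is_adjoint inner a a"

lemma is_adjointD: "is_adjoint inner a b \<Longrightarrow> inner (a x) y = inner x (b y)"
  by (simp add: is_adjoint_def)

lemma is_adjoint_sym: "is_adjoint inner a b \<Longrightarrow> is_adjoint inner b a"
  by (metis is_adjoint_def inner_commute)

lemma is_adjoint_unique:
  assumes "is_adjoint inner a b" "is_adjoint inner a c"
  shows "b = c"
proof (rule blinfun_eqI)
  fix y
  have "inner x (b y - c y) = 0" for x
    using assms by (simp add: is_adjoint_def inner_diff_right)
  then show "b y = c y" by (metis inner_eq_zero_iff eq_iff_diff_eq_0)
qed

lemma is_adjoint_add:
  "is_adjoint inner a b \<Longrightarrow> is_adjoint inner c d \<Longrightarrow> is_adjoint inner (a + c) (b + d)"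
  by (simp add: is_adjoint_def blinfun.add_left inner_add_left inner_add_right)

lemma is_adjoint_diff:
  "is_adjoint inner a b \<Longrightarrow> is_adjoint inner c d \<Longrightarrow> is_adjoint inner (a - c) (b - d)"
  by (simp add: is_adjoint_def blinfun.diff_left inner_diff_left inner_diff_right)

lemma is_adjoint_scaleR:
  "is_adjoint inner a b \<Longrightarrow> is_adjoint inner (r *\<^sub>R a) (r *\<^sub>R b)"
  by (simp add: is_adjoint_def blinfun.scaleR_left)

lemma is_adjoint_compose:
  "is_adjoint inner a b \<Longrightarrow> is_adjoint inner c d \<Longrightarrow> is_adjoint inner (a o\<^sub>L c) (d o\<^sub>L b)"
  by (simp add: is_adjoint_def)

lemma self_adjoint_id: "self_adjoint id_blinfun"
  by (simp add: is_adjoint_def)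

lemmas is_adjoint_intros =
  is_adjoint_add is_adjoint_diff is_adjoint_scaleR is_adjoint_compose self_adjoint_id

lemma is_adjoint_norm_le:
  assumes "is_adjoint inner a b"
  shows "norm b \<le> norm a"
proof (rule norm_blinfun_bound)
  fix y
  have "norm (b y) * norm (b y) = inner (a (b y)) y"
    by (metis assms is_adjointD norm_eq_sqrt_inner power2_eq_square power2_norm_eq_inner)
  also have "\<dots> \<le> norm (a (b y)) * norm y" by (rule norm_cauchy_schwarz)
  also have "\<dots> \<le> (norm a * norm (b y)) * norm y"
    by (intro mult_right_mono norm_blinfun) auto
  finally have "norm (b y) * norm (b y) \<le> norm (b y) * (norm a * norm y)" by (simp add: ac_simps)
  then show "norm (b y) \<le> norm a * norm y"
    by (cases "b y = 0") (simp_all add: mult_le_cancel_left)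
qed simp

lemma is_adjoint_norm_eq: "is_adjoint inner a b \<Longrightarrow> norm b = norm a"
  by (meson is_adjoint_norm_le is_adjoint_sym order_antisym)

lemma closed_self_adjoint: "closed {a :: 'h::{real_inner, complete_space} \<Rightarrow>\<^sub>L 'h. self_adjoint a}"
  unfolding is_adjoint_def
  by (intro closed_Collect_all closed_Collect_eq continuous_intros)

text \<open>Polarization expresses \<open>inner (a x) y\<close> by the quadratic form at
  \<open>x + y\<close> and \<open>x - y\<close>, and the parallelogram law adds up the two
  bounds.\<close>

lemma self_adjoint_norm_le:
  assumes a: "self_adjoint a" and c: "\<And>x. \<bar>inner (a x) x\<bar> \<le> c * (norm x)\<^sup>2" and "0 \<le> c"
  shows "norm a \<le> c"
proof (rule norm_blinfun_bound)
  fix x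
  show "norm (a x) \<le> c * norm x"
  proof (cases "a x = 0")
    case False
    have sym: "inner (a x) y = inner (a y) x" for y
      using is_adjointD[OF a, of x y] by (simp add: inner_commute)
    have par: "4 * inner (a x) y \<le> 2 * c * ((norm x)\<^sup>2 + (norm y)\<^sup>2)" for y
    proof -
      have "4 * inner (a x) y = inner (a (x + y)) (x + y) - inner (a (x - y)) (x - y)"
        using sym[of y] by (simp add: blinfun.bilinear_simps inner_add_left inner_add_right inner_diff_left inner_diff_right)
      also have "\<dots> \<le> c * (norm (x + y))\<^sup>2 + c * (norm (x - y))\<^sup>2"
        using c[of "x + y"] c[of "x - y"] by linarith
      also have "\<dots> = 2 * c * ((norm x)\<^sup>2 + (norm y)\<^sup>2)"
        by (simp add: power2_norm_eq_inner algebra_simps inner_add_left inner_add_right inner_diff_left inner_diff_right inner_commute)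
      finally show ?thesis .
    qed
    \<comment> \<open>The test vector points along \<open>a x\<close> and has the length of
      \<open>x\<close>, so both squares in \<open>par\<close> agree.\<close>
    define t where "t = norm x / norm (a x)"
    have t: "norm (t *\<^sub>R a x) = norm x" "inner (a x) (t *\<^sub>R a x) = norm x * norm (a x)"
      using False by (auto simp: t_def power2_norm_eq_inner[symmetric] power2_eq_square)
    have "norm x * norm (a x) \<le> norm x * (c * norm x)"
      using par[of "t *\<^sub>R a x"] unfolding t by (simp add: power2_eq_square algebra_simps)
    moreover have "x \<noteq> 0" using False by auto
    ultimately show ?thesis by (simp add: mult_le_cancel_left)
  qed (use \<open>0 \<le> c\<close> in simp)
qed fact

lemma self_adjoint_compose_commute:
  assumes "self_adjoint a" "self_adjoint b" "a o\<^sub>L b = b"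
  shows "b o\<^sub>L a = b"
  using is_adjoint_unique[OF is_adjoint_compose[OF assms(1,2)]] assms by metis

section \<open>The positive spectral projection of an invertible self-adjoint operator\<close>

text \<open>
  \<open>y = 1 - sqrt t\<close> is the fixed point of \<open>y \<mapsto> ((1 - t) + y\<^sup>2) / 2\<close>, a contraction with constant
  \<open>\<rho> = 1 - sqrt \<kappa>\<close> on the ball of radius \<open>\<rho>\<close> if \<open>\<parallel>1 - t\<parallel> \<le> 1 - \<kappa>\<close>.
\<close>

lemma sqrt_fixed_point:
  fixes D :: "('h::{real_inner, complete_space} \<Rightarrow>\<^sub>L 'h) set" and h :: "'h \<Rightarrow>\<^sub>L 'h"
  assumes D: "closed D" "0 \<in> D" "\<And>y. y \<in> D \<Longrightarrow> (1/2) *\<^sub>R (h + (y o\<^sub>L y)) \<in> D"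
    and \<kappa>: "0 < \<kappa>" "\<kappa> \<le> 1" "norm h \<le> 1 - \<kappa>"
  obtains y where "y \<in> D" "norm y < 1" "y + y = h + (y o\<^sub>L y)"
proof -
  define \<rho> where "\<rho> = 1 - sqrt \<kappa>"
  \<comment> \<open>The equation says that the worst-case bound for \<open>f\<close> on the ball of
    radius \<rho> is again \<rho>.\<close>
  have \<rho>: "0 \<le> \<rho>" "\<rho> < 1" "(1/2) * (1 - \<kappa> + \<rho> * \<rho>) = \<rho>"
    using \<kappa> by (auto simp: \<rho>_def algebra_simps)
  define f where "f y = (1/2) *\<^sub>R (h + (y o\<^sub>L y))" for y :: "'h \<Rightarrow>\<^sub>L 'h"
  have "\<exists>!y\<in>D \<inter> cball 0 \<rho>. f y = y"
  proof (rule Banach_fix[where c = \<rho>])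
    show "complete (D \<inter> cball 0 \<rho>)" by (intro complete_closed_blinfun closed_Int D) simp
    show "D \<inter> cball 0 \<rho> \<noteq> {}" using D \<rho> by auto
    show "f ` (D \<inter> cball 0 \<rho>) \<subseteq> D \<inter> cball 0 \<rho>"
    proof safe
      fix y assume y: "y \<in> D" "y \<in> cball 0 \<rho>"
      show "f y \<in> D" unfolding f_def by (rule D) fact
      have "norm (y o\<^sub>L y) \<le> \<rho> * \<rho>"
        using y \<rho> by (intro order_trans[OF norm_blinfun_compose] mult_mono) auto
      then have "norm (h + (y o\<^sub>L y)) \<le> 1 - \<kappa> + \<rho> * \<rho>"
        using \<kappa>(3) norm_triangle_ineq[of h "y o\<^sub>L y"] by linarith
      then have "norm (f y) \<le> (1/2) * (1 - \<kappa> + \<rho> * \<rho>)" by (simp add: f_def)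
      then show "f y \<in> cball 0 \<rho>" unfolding \<rho>(3) by simp
    qed
    fix x y assume xy: "x \<in> D \<inter> cball 0 \<rho>" "y \<in> D \<inter> cball 0 \<rho>"
    \<comment> \<open>The difference of squares is factored without commuting \<open>x\<close> and
      \<open>y\<close>; each summand contributes \<rho>, and the factor 1/2 averages them.\<close>
    have "f x - f y = (1/2) *\<^sub>R ((x o\<^sub>L (x - y)) + ((x - y) o\<^sub>L y))"
      by (simp add: f_def blinfun_compose_simps algebra_simps)
    moreover have "norm (x o\<^sub>L (x - y)) \<le> \<rho> * norm (x - y)"
      using xy by (intro order_trans[OF norm_blinfun_compose] mult_right_mono) auto
    moreover have "norm ((x - y) o\<^sub>L y) \<le> norm (x - y) * \<rho>"
      using xy by (intro order_trans[OF norm_blinfun_compose] mult_left_mono) auto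
    ultimately show "dist (f x) (f y) \<le> \<rho> * dist x y"
      using norm_triangle_ineq[of "x o\<^sub>L (x - y)" "(x - y) o\<^sub>L y"] by (simp add: dist_norm mult.commute)
  qed (use \<rho> in auto)
  then obtain y where y: "y \<in> D \<inter> cball 0 \<rho>" "f y = y" by blast
  have "y + y = 2 *\<^sub>R f y" by (simp add: y(2) scaleR_2)
  also have "\<dots> = h + (y o\<^sub>L y)" by (simp add: f_def)
  finally show ?thesis using y(1) \<rho>(2) by (intro that[of y]) auto
qed

text \<open>Membership in an algebra is kept apart, because complements and spectral projections
  first live outside \<open>A\<close>.\<close>

definition is_projection :: "('h::{real_inner, complete_space} \<Rightarrow>\<^sub>L 'h) \<Rightarrow> bool" where
  "is_projection p \<longleftrightarrow> self_adjoint p \<and> p o\<^sub>L p = p"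

lemma is_projection_idem: "is_projection p \<Longrightarrow> p (p x) = p x"
  by (metis blinfun_apply_blinfun_compose is_projection_def)

lemma is_projection_inner: "is_projection p \<Longrightarrow> inner (p x) y = inner x (p y)"
  by (simp add: is_projection_def is_adjointD)

lemma is_projection_compl: "is_projection p \<Longrightarrow> is_projection (id_blinfun - p)"
  using is_projection_idem[of p]
  by (auto simp: is_projection_def blinfun.bilinear_simps intro!: is_adjoint_intros blinfun_eqI)

lemma is_projection_id: "is_projection id_blinfun"
  by (auto simp: is_projection_def self_adjoint_id intro!: blinfun_eqI)

lemma is_projection_norm_apply_le:
  assumes "is_projection p"
  shows "norm (p x) \<le> norm x"
proof -
  have "norm (p x) * norm (p x) = inner (p x) x"
    using assms by (metis is_projection_idem is_projection_inner power2_eq_square power2_norm_eq_inner)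
  also have "\<dots> \<le> norm (p x) * norm x" by (rule norm_cauchy_schwarz)
  finally show ?thesis by (cases "p x = 0") simp_all
qed

lemma is_projection_norm_le: "is_projection p \<Longrightarrow> norm p \<le> 1"
  by (rule norm_blinfun_bound) (simp_all add: is_projection_norm_apply_le)

lemma is_projection_compose_commute:
  "is_projection p \<Longrightarrow> is_projection q \<Longrightarrow> p o\<^sub>L q = q \<Longrightarrow> q o\<^sub>L p = q"
  by (simp add: is_projection_def self_adjoint_compose_commute)

text \<open>Self-adjointness is tracked separately in each construction, so the idealizer of
  \<open>A\<close> qualifies without producing adjoints of its elements.\<close>

definition closed_unital_algebra :: "('h::{real_inner, complete_space} \<Rightarrow>\<^sub>L 'h) set \<Rightarrow> bool" where
  "closed_unital_algebra M \<longleftrightarrow> closed M \<and> id_blinfun \<in> M \<and>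
     (\<forall>a\<in>M. \<forall>b\<in>M. a + b \<in> M \<and> a o\<^sub>L b \<in> M) \<and> (\<forall>r. \<forall>a\<in>M. r *\<^sub>R a \<in> M)"

lemma closed_unital_algebraD:
  assumes "closed_unital_algebra M"
  shows "closed M" "id_blinfun \<in> M"
    "a \<in> M \<Longrightarrow> b \<in> M \<Longrightarrow> a + b \<in> M" "a \<in> M \<Longrightarrow> b \<in> M \<Longrightarrow> a o\<^sub>L b \<in> M"
    "a \<in> M \<Longrightarrow> r *\<^sub>R a \<in> M"
  using assms by (auto simp: closed_unital_algebra_def)

lemma closed_unital_algebra_diff:
  assumes "closed_unital_algebra M" "a \<in> M" "b \<in> M"
  shows "a - b \<in> M"
proof -
  have "a + (-1) *\<^sub>R b \<in> M" using assms by (intro closed_unital_algebraD)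
  then show ?thesis by simp
qed

text \<open>The projection is (1 + sgn b)/2. Here sgn b is |b| times the inverse \<open>c\<close> of
  \<open>b\<close>, and |b|/L is the square root of b^2/L^2, which is at distance less than 1 from
  the identity.\<close>

lemma spectral_projection:
  assumes M: "closed_unital_algebra M" and bM: "b \<in> M" "c \<in> M" and b: "self_adjoint b"
    and bc: "b o\<^sub>L c = id_blinfun" "c o\<^sub>L b = id_blinfun"
  obtains p where "p \<in> M" "is_projection p" "b o\<^sub>L p = p o\<^sub>L b"
    "\<And>x. p x = x \<Longrightarrow> 0 \<le> inner (b x) x" "\<And>x. p x = 0 \<Longrightarrow> inner (b x) x \<le> 0"
proof -
  note Ms = closed_unital_algebraD[OF M] closed_unital_algebra_diff[OF M]
  have bcx: "b (c x) = x" "c (b x) = x" for x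
    using bc by (metis blinfun_apply_blinfun_compose id_blinfun.rep_eq id_apply)+
  \<comment> \<open>\<open>L\<close> bounds \<open>b\<close> from above and \<open>K\<close> bounds
    it from below, so that b^2/L^2 lies between 1/(LK)^2 and 1. Adding 1 makes both constants at
    least 1.\<close>
  define L where "L = norm b + 1"
  define K where "K = norm c + 1"
  have L: "L \<ge> 1" "norm (b x) \<le> L * norm x" for x
    using order_trans[OF norm_blinfun[of b x] mult_right_mono[of "norm b" L]] by (auto simp: L_def)
  have K: "K \<ge> 1" "norm x \<le> K * norm (b x)" for x
    using order_trans[OF norm_blinfun[of c "b x"] mult_right_mono[of "norm c" K]] by (auto simp: K_def bcx)
  define h where "h = id_blinfun - (1 / L\<^sup>2) *\<^sub>R (b o\<^sub>L b)"
  have h_sa: "self_adjoint h" unfolding h_def by (intro is_adjoint_intros b)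
  have \<kappa>: "0 < 1 / (L * K)\<^sup>2" "1 / (L * K)\<^sup>2 \<le> 1"
  proof -
    have "1 \<le> L * K" using mult_mono[of 1 L 1 K] L(1) K(1) by simp
    then show "0 < 1 / (L * K)\<^sup>2" using L(1) K(1) by simp
    have "1 \<le> (L * K)\<^sup>2" using \<open>1 \<le> L * K\<close> by (rule one_le_power)
    then show "1 / (L * K)\<^sup>2 \<le> 1" by (subst pos_divide_le_eq) linarith+
  qed
  have "norm h \<le> 1 - 1 / (L * K)\<^sup>2"
  proof (rule self_adjoint_norm_le[OF h_sa])
    fix x
    have "inner (b (b x)) x = (norm (b x))\<^sup>2"
      using is_adjointD[OF b, of "b x" x] by (simp add: power2_norm_eq_inner)
    then have eq: "inner (h x) x = (norm x)\<^sup>2 - (norm (b x))\<^sup>2 / L\<^sup>2"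
      by (simp add: h_def blinfun.bilinear_simps inner_diff_left power2_norm_eq_inner)
    have "(norm (b x))\<^sup>2 \<le> (L * norm x)\<^sup>2" using L by (intro power_mono) auto
    then have "0 \<le> inner (h x) x" using L(1) unfolding eq by (simp add: field_simps)
    moreover have "(norm x)\<^sup>2 \<le> (K * norm (b x))\<^sup>2" using K by (intro power_mono) auto
    then have "(norm x)\<^sup>2 / (L * K)\<^sup>2 \<le> (norm (b x))\<^sup>2 / L\<^sup>2"
      using L(1) K(1) by (simp add: field_simps)
    then have "inner (h x) x \<le> (1 - 1 / (L * K)\<^sup>2) * (norm x)\<^sup>2"
      unfolding eq by (simp add: algebra_simps)
    ultimately show "\<bar>inner (h x) x\<bar> \<le> (1 - 1 / (L * K)\<^sup>2) * (norm x)\<^sup>2" by simp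
  next
    show "0 \<le> 1 - 1 / (L * K)\<^sup>2" using \<kappa>(2) by linarith
  qed
  moreover note \<kappa>
  \<comment> \<open>These constraints are closed and preserved by the iteration, so the square root
    inherits self-adjointness and commutation with \<open>b\<close>.\<close>
  moreover define D where "D = M \<inter> {y. self_adjoint y} \<inter> {y. b o\<^sub>L y = y o\<^sub>L b}"
  have "closed D"
    unfolding D_def by (intro closed_Int Ms(1) closed_self_adjoint closed_Collect_eq continuous_intros)
  moreover have "0 \<in> D"
    using Ms(5)[OF bM(1), of 0] by (simp add: D_def is_adjoint_def)
  moreover have "(1/2) *\<^sub>R (h + (y o\<^sub>L y)) \<in> D" if "y \<in> D" for y
  proof -
    have y: "y \<in> M" "self_adjoint y" "b o\<^sub>L y = y o\<^sub>L b" using that by (auto simp: D_def)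
    have "b (y x) = y (b x)" for x using y(3) by (metis blinfun_apply_blinfun_compose)
    then have "b o\<^sub>L ((1/2) *\<^sub>R (h + (y o\<^sub>L y))) = ((1/2) *\<^sub>R (h + (y o\<^sub>L y))) o\<^sub>L b"
      by (intro blinfun_eqI) (simp add: h_def blinfun.bilinear_simps)
    moreover have "h \<in> M" unfolding h_def by (intro Ms bM)
    ultimately show ?thesis
      unfolding D_def by (auto intro!: Ms is_adjoint_intros h_sa y)
  qed
  ultimately obtain y where y: "y \<in> D" "norm y < 1" "y + y = h + (y o\<^sub>L y)"
    using sqrt_fixed_point by blast
  define s where "s = id_blinfun - y"
  have yD: "y \<in> M" "self_adjoint y" "b o\<^sub>L y = y o\<^sub>L b" using y(1) by (simp_all add: D_def)
  have s: "s \<in> M" "self_adjoint s"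
    unfolding s_def by (intro Ms(6) Ms(2) is_adjoint_intros yD)+
  have bs: "b (s x) = s (b x)" for x
  proof -
    have "b (y x) = y (b x)" using yD(3) by (metis blinfun_apply_blinfun_compose)
    then show ?thesis by (simp add: s_def blinfun.bilinear_simps)
  qed
  have cs: "c (s x) = s (c x)" for x by (metis bcx bs)
  have ss: "s (s x) = (1 / L\<^sup>2) *\<^sub>R b (b x)" for x
  proof -
    have "y x + y x = h x + y (y x)"
      using arg_cong[OF y(3), of "\<lambda>a. a x"] by (simp add: blinfun.add_left)
    then show ?thesis by (simp add: s_def h_def blinfun.bilinear_simps algebra_simps)
  qed
  \<comment> \<open>As \<open>s\<close> is |b|/L, this is the sign of \<open>b\<close>, a
    self-adjoint involution.\<close>
  define \<sigma> where "\<sigma> = L *\<^sub>R (s o\<^sub>L c)"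
  have \<sigma>\<sigma>: "\<sigma> (\<sigma> x) = x" for x
    using L(1) by (simp add: \<sigma>_def blinfun.bilinear_simps cs ss bcx power2_eq_square)
  have b\<sigma>: "b (\<sigma> x) = L *\<^sub>R s x" "\<sigma> (b x) = L *\<^sub>R s x" for x
    by (simp_all add: \<sigma>_def blinfun.bilinear_simps bs bcx)
  have c: "self_adjoint c"
    unfolding is_adjoint_def using is_adjointD[OF b] by (metis bcx)
  have "s o\<^sub>L c = c o\<^sub>L s" by (intro blinfun_eqI) (simp add: cs)
  then have \<sigma>_sa: "self_adjoint \<sigma>"
    unfolding \<sigma>_def using is_adjoint_scaleR[OF is_adjoint_compose[OF s(2) c], of L] by simp
  define p where "p = (1/2) *\<^sub>R (id_blinfun + \<sigma>)"
  have p_apply: "p x = (1/2) *\<^sub>R (x + \<sigma> x)" for x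
    by (simp add: p_def blinfun.bilinear_simps)
  \<comment> \<open>The bound \<open>norm y < 1\<close> selects the positive square root.\<close>
  have s_pos: "0 \<le> inner (s x) x" for x
  proof -
    have "inner (y x) x \<le> norm (y x) * norm x" by (rule norm_cauchy_schwarz)
    also have "\<dots> \<le> (1 * norm x) * norm x"
      using y(2) by (intro mult_right_mono order_trans[OF norm_blinfun]) auto
    finally show ?thesis
      by (simp add: s_def blinfun.bilinear_simps inner_diff_left power2_eq_square flip: power2_norm_eq_inner)
  qed
  show ?thesis
  proof (rule that)
    show "p \<in> M" unfolding p_def \<sigma>_def by (intro Ms s bM)
    have "\<sigma> (p x) = p x" for x
      by (simp add: p_apply blinfun.bilinear_simps \<sigma>\<sigma> add.commute)
    then have "p (p x) = p x" for x
      by (subst p_apply) (simp add: scaleR_half_double)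
    then have "p o\<^sub>L p = p" by (intro blinfun_eqI) simp
    then show "is_projection p"
      unfolding is_projection_def p_def by (auto intro!: is_adjoint_intros \<sigma>_sa)
    show "b o\<^sub>L p = p o\<^sub>L b"
      by (rule blinfun_eqI) (simp add: p_apply blinfun.bilinear_simps b\<sigma>)
    fix x
    \<comment> \<open>On the range of \<open>p\<close> the sign is 1 and \<open>b\<close> acts as
      |b|; on the kernel it acts as -|b|.\<close>
    show "0 \<le> inner (b x) x" if "p x = x"
    proof -
      have "2 *\<^sub>R p x = x + \<sigma> x" by (simp add: p_apply)
      then have "\<sigma> x = x" using that by (simp add: scaleR_2)
      then have "b x = L *\<^sub>R s x" using b\<sigma>(1)[of x] by simp
      then show ?thesis using L(1) s_pos by simp
    qed
    show "inner (b x) x \<le> 0" if "p x = 0"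
    proof -
      have "2 *\<^sub>R p x = x + \<sigma> x" by (simp add: p_apply)
      then have "\<sigma> x = - x" using that by (simp add: add_eq_0_iff)
      then have "- b x = L *\<^sub>R s x"
        using b\<sigma>(1)[of x] by (simp add: blinfun.minus_right)
      then have "- inner (b x) x = L * inner (s x) x"
        by (metis inner_minus_left inner_scaleR_left)
      moreover have "0 \<le> L * inner (s x) x" using L(1) s_pos by simp
      ultimately show ?thesis by linarith
    qed
  qed
qed

section \<open>Multipliers of the algebra and range projections\<close>

text \<open>A concrete substitute for the multiplier algebra: for a C*-algebra \<open>A\<close> it
  contains the identity and has \<open>A\<close> as an ideal, so a product of multipliers with one
  factor in \<open>A\<close> falls back into \<open>A\<close>.\<close>

definition idealizer :: "('h::{real_inner, complete_space} \<Rightarrow>\<^sub>L 'h) set \<Rightarrow> ('h \<Rightarrow>\<^sub>L 'h) set" where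
  "idealizer A = {m. \<forall>a\<in>A. m o\<^sub>L a \<in> A \<and> a o\<^sub>L m \<in> A}"

lemma idealizerD: "m \<in> idealizer A \<Longrightarrow> a \<in> A \<Longrightarrow> m o\<^sub>L a \<in> A"
    "m \<in> idealizer A \<Longrightarrow> a \<in> A \<Longrightarrow> a o\<^sub>L m \<in> A"
  by (auto simp: idealizer_def)

lemma op_scale_scaleR: "op_scale scaleR r a = r *\<^sub>R a"
  by (rule blinfun_eqI)
     (simp add: hilbert_space.op_scale_apply[OF hilbert_space_real] blinfun.scaleR_left)

context
  fixes A :: "('h::{real_inner, complete_space} \<Rightarrow>\<^sub>L 'h) set"
  assumes A: "cstar_algebra scaleR inner A"
begin

lemma cstar_closed: "closed A"
  and cstar_add: "a \<in> A \<Longrightarrow> b \<in> A \<Longrightarrow> a + b \<in> A"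
  and cstar_scaleR: "a \<in> A \<Longrightarrow> r *\<^sub>R a \<in> A"
  and cstar_compose: "a \<in> A \<Longrightarrow> b \<in> A \<Longrightarrow> a o\<^sub>L b \<in> A"
  and cstar_adjoint: "a \<in> A \<Longrightarrow> \<exists>b\<in>A. is_adjoint inner a b"
  using A by (simp_all add: cstar_algebra_def op_scale_scaleR)

lemma cstar_diff: "a \<in> A \<Longrightarrow> b \<in> A \<Longrightarrow> a - b \<in> A"
  using cstar_add[of a "(-1) *\<^sub>R b"] cstar_scaleR[of b "-1"] by simp

lemma cstar_subset_idealizer: "A \<subseteq> idealizer A"
  by (auto simp: idealizer_def cstar_compose)

lemma closed_unital_algebra_idealizer: "closed_unital_algebra (idealizer A)"
proof -
  have "idealizer A = (\<Inter>a\<in>A. (\<lambda>m. m o\<^sub>L a) -` A \<inter> (\<lambda>m. a o\<^sub>L m) -` A)"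
    by (auto simp: idealizer_def)
  moreover have "closed \<dots>"
    by (intro closed_INT ballI closed_Int closed_vimage cstar_closed continuous_intros)
  ultimately have "closed (idealizer A)" by simp
  moreover have "id_blinfun o\<^sub>L a = a" "a o\<^sub>L id_blinfun = a" for a :: "'h \<Rightarrow>\<^sub>L 'h"
    by (auto intro: blinfun_eqI)
  moreover have "(a o\<^sub>L b) o\<^sub>L d \<in> A \<and> d o\<^sub>L (a o\<^sub>L b) \<in> A"
    if "a \<in> idealizer A" "b \<in> idealizer A" "d \<in> A" for a b d
    using that by (metis blinfun_compose_assoc idealizerD)
  ultimately show ?thesis
    unfolding closed_unital_algebra_def
    by (auto simp: idealizer_def blinfun_compose_simps intro: cstar_add cstar_scaleR)
qed

text \<open>With Y the adjoint of X, \<open>r\<close> is X (Y X)^{-1} Y, the inverse being taken in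
  the corner of \<open>p\<close>, where Y X is close to \<open>p\<close>. The bounded factor
  \<open>W\<close> transfers an estimate for a multiple of X to the same multiple of
  \<open>r\<close>.\<close>

lemma range_projection:
  assumes X: "X \<in> A" and p: "p \<in> A" "is_projection p" and Xp: "X o\<^sub>L p = X"
    and close: "norm (X - p) \<le> 1/4"
  obtains r W where "r \<in> A" "is_projection r" "r o\<^sub>L X = X" "r = X o\<^sub>L W" "norm W \<le> 4"
proof -
  note psa = p(2)[unfolded is_projection_def]
  obtain Y where Y: "Y \<in> A" "is_adjoint inner X Y" using cstar_adjoint[OF X] by blast
  have Yp: "norm (Y - p) \<le> 1/4"
    using is_adjoint_norm_eq[OF is_adjoint_diff[OF Y(2) conjunct1[OF psa]]] close by simp
  have nY: "norm Y \<le> 5/4"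
    using norm_triangle_ineq[of "Y - p" p] Yp is_projection_norm_le[OF p(2)] by simp
  define u where "u = p - (Y o\<^sub>L X)"
  have up: "u o\<^sub>L p = u" by (simp add: u_def blinfun_compose_simps psa Xp)
  \<comment> \<open>Inserting \<open>Y o\<^sub>L p\<close> separates the errors of \<open>Y\<close>
    and \<open>X\<close>, giving 1/4 + 5/16 = 9/16.\<close>
  have "u = - ((Y - p) o\<^sub>L p) - (Y o\<^sub>L (X - p))"
    by (simp add: u_def blinfun_compose_simps psa Xp)
  then have "norm u \<le> norm ((Y - p) o\<^sub>L p) + norm (Y o\<^sub>L (X - p))"
    by (metis norm_minus_cancel norm_triangle_ineq4)
  also have "\<dots> \<le> 1/4 * 1 + 5/4 * (1/4)"
    by (intro add_mono order_trans[OF norm_blinfun_compose] mult_mono)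
       (use Yp nY close is_projection_norm_le[OF p(2)] in auto)
  finally have nu: "norm u \<le> 9/16" by simp
  have uA: "u \<in> A" unfolding u_def by (intro cstar_diff cstar_compose p X Y)
  obtain g where g: "g \<in> A" "g = p + (g o\<^sub>L u)"
    using neumann_right[of A p u] cstar_closed p(1) nu uA cstar_add cstar_compose by auto
  \<comment> \<open>Absorbing the term with 9/16 gives 16/7, and 16/7 times 5/4 stays below
    4.\<close>
  have "norm g \<le> norm p + norm (g o\<^sub>L u)" by (subst g(2)) (rule norm_triangle_ineq)
  also have "\<dots> \<le> 1 + norm g * (9/16)"
    by (intro add_mono order_trans[OF norm_blinfun_compose] mult_left_mono nu is_projection_norm_le p) simp
  finally have ng: "norm g \<le> 16/7" by simp
  have gp: "g o\<^sub>L p = g"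
  proof -
    have "g o\<^sub>L p = (p + (g o\<^sub>L u)) o\<^sub>L p" by (simp flip: g(2))
    also have "\<dots> = p + (g o\<^sub>L u)" by (simp add: blinfun_compose_simps psa up)
    finally show ?thesis by (simp flip: g(2))
  qed
  have gYX: "g o\<^sub>L (Y o\<^sub>L X) = p"
  proof -
    have "g o\<^sub>L u = (g o\<^sub>L p) - (g o\<^sub>L (Y o\<^sub>L X))" by (simp add: u_def blinfun_compose_simps)
    moreover have "g o\<^sub>L u = g - p" using g(2) by (metis add_diff_cancel_left')
    ultimately show ?thesis by (simp add: gp)
  qed
  \<comment> \<open>In the corner of \<open>p\<close>, \<open>g\<close> is a left inverse of the
    self-adjoint Y X, so its adjoint is a right inverse, and the two coincide.\<close>
  have gsa: "self_adjoint g"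
  proof -
    from cstar_adjoint[OF g(1)] obtain g' where g': "is_adjoint inner g g'" ..
    have YX: "self_adjoint (Y o\<^sub>L X)"
      by (rule is_adjoint_compose[OF is_adjoint_sym[OF Y(2)] Y(2)])
    have "is_adjoint inner p ((Y o\<^sub>L X) o\<^sub>L g')" using is_adjoint_compose[OF g' YX] gYX by simp
    then have "(Y o\<^sub>L X) o\<^sub>L g' = p" using psa is_adjoint_unique by blast
    then have "g o\<^sub>L p = p o\<^sub>L g'" using gYX by (metis blinfun_compose_assoc)
    moreover have "p o\<^sub>L g' = g'"
      using is_adjoint_compose[OF g' conjunct1[OF psa]] g' is_adjoint_unique gp by metis
    ultimately show ?thesis using g' gp by simp
  qed
  define r where "r = X o\<^sub>L (g o\<^sub>L Y)"
  have XgYX: "X o\<^sub>L (g o\<^sub>L (Y o\<^sub>L X)) = X" using gYX Xp by simp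
  show ?thesis
  proof (rule that[of r "g o\<^sub>L Y"])
    show "r \<in> A" unfolding r_def by (intro cstar_compose X Y g)
    show "r o\<^sub>L X = X" using XgYX by (simp add: r_def blinfun_compose_assoc)
    then have "r o\<^sub>L r = r" by (metis r_def blinfun_compose_assoc)
    moreover have "self_adjoint r"
      using is_adjoint_compose[OF Y(2) is_adjoint_compose[OF gsa is_adjoint_sym[OF Y(2)]]]
      by (simp add: r_def blinfun_compose_assoc)
    ultimately show "is_projection r" by (simp add: is_projection_def)
    have "norm (g o\<^sub>L Y) \<le> 16/7 * (5/4)"
      by (intro order_trans[OF norm_blinfun_compose] mult_mono ng nY) auto
    then show "norm (g o\<^sub>L Y) \<le> 4" by simp
  qed (simp add: r_def)
qed

end

section \<open>Projections containing the approximate eigenvectors\<close>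

text \<open>
  The form in which real rank zero is used. Working in the idealizer makes the identity operator
  available whether or not \<open>A\<close> has a unit and whatever that unit is.
\<close>

definition dense_invertibles :: "('h::{real_inner, complete_space} \<Rightarrow>\<^sub>L 'h) set \<Rightarrow> bool" where
  "dense_invertibles A \<longleftrightarrow>
     (\<forall>S\<in>A. \<forall>l>0. \<forall>\<eta>>0. self_adjoint S \<longrightarrow>
        (\<exists>b\<in>idealizer A. \<exists>c\<in>idealizer A. self_adjoint b \<and> b o\<^sub>L c = id_blinfun \<and>
           c o\<^sub>L b = id_blinfun \<and> norm (b - (S - l *\<^sub>R id_blinfun)) \<le> \<eta>))"

lemma compose_id [simp]: "id_blinfun o\<^sub>L a = a" "a o\<^sub>L id_blinfun = a"
  by (auto intro: blinfun_eqI)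

context
  fixes S :: "'h::{real_inner, complete_space} \<Rightarrow>\<^sub>L 'h"
  assumes S: "\<And>x. (norm (S x))\<^sup>2 \<le> inner (S x) x"
begin

lemma form_nonneg: "0 \<le> inner (S x) x"
  using S[of x] by (meson order_trans zero_le_power2)

text \<open>For self-adjoint \<open>S\<close> the assumption of this context reads S^2 \<le> S, that
  is, 0 \<le> S \<le> 1. It passes to 1 - S by expanding the square.\<close>

lemma norm_defect_sq_le_form: "(norm (x - S x))\<^sup>2 \<le> inner (x - S x) x"
  using S[of x] by (simp add: power2_norm_eq_inner inner_diff_left inner_diff_right inner_commute)

lemma norm_defect_le_norm: "norm (x - S x) \<le> norm x"
proof -
  have "norm (x - S x) * norm (x - S x) \<le> norm (x - S x) * norm x"
    using norm_defect_sq_le_form[of x] norm_cauchy_schwarz[of "x - S x" x] by (simp add: power2_eq_square)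
  then show ?thesis by (cases "x - S x = 0") (simp_all add: mult_le_cancel_left)
qed

end

context
  fixes A :: "('h::{real_inner, complete_space} \<Rightarrow>\<^sub>L 'h) set" and S :: "'h \<Rightarrow>\<^sub>L 'h"
  assumes A: "cstar_algebra scaleR inner A" and inv: "dense_invertibles A"
    and S: "S \<in> A" "self_adjoint S" "\<And>x. (norm (S x))\<^sup>2 \<le> inner (S x) x"
begin

lemmas positive_part = form_nonneg[OF S(3)]
lemmas norm_defect_sq_le = norm_defect_sq_le_form[OF S(3)]
lemmas norm_defect_le = norm_defect_le_norm[OF S(3)]

text \<open>Take the positive spectral projection of an invertible \<open>b\<close> within \<eta> of
  S - (1 - \<delta>). The sign of \<open>b\<close> gives both form estimates up to \<eta>, and since
  \<open>p\<close> commutes with \<open>b\<close>, it almost reduces \<open>S\<close>.\<close>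

lemma approximate_spectral_projection:
  assumes "0 < \<delta>" "0 < \<eta>" "\<delta> + \<eta> < 1"
  obtains p where "p \<in> A" "is_projection p"
    "\<And>x. p x = x \<Longrightarrow> inner (x - S x) x \<le> (\<delta> + \<eta>) * (norm x)\<^sup>2"
    "\<And>x. p x = 0 \<Longrightarrow> (\<delta> - \<eta>) * (norm x)\<^sup>2 \<le> inner (x - S x) x"
    "norm ((id_blinfun - p) o\<^sub>L (S o\<^sub>L p)) \<le> \<eta>"
proof -
  \<comment> \<open>\<open>dense_invertibles\<close> asks for a positive shift, which \<delta> < 1
    provides.\<close>
  define l where "l = 1 - \<delta>"
  obtain b c where b: "b \<in> idealizer A" "c \<in> idealizer A" "self_adjoint b"
      "b o\<^sub>L c = id_blinfun" "c o\<^sub>L b = id_blinfun" "norm (b - (S - l *\<^sub>R id_blinfun)) \<le> \<eta>"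
  proof -
    have "l > 0" using assms by (simp add: l_def)
    then show ?thesis using inv S(1,2) \<open>0 < \<eta>\<close> that unfolding dense_invertibles_def by blast
  qed
  obtain p where p: "p \<in> idealizer A" "is_projection p" "b o\<^sub>L p = p o\<^sub>L b"
    "\<And>x. p x = x \<Longrightarrow> 0 \<le> inner (b x) x" "\<And>x. p x = 0 \<Longrightarrow> inner (b x) x \<le> 0"
    using spectral_projection[OF closed_unital_algebra_idealizer[OF A] b(1-5)] by blast
  note pp = is_projection_idem[OF p(2)]
  define e where "e = b - (S - l *\<^sub>R id_blinfun)"
  have Sx: "x - S x = \<delta> *\<^sub>R x - b x + e x" for x
    by (simp add: e_def l_def blinfun.bilinear_simps algebra_simps)
  have e: "\<bar>inner (e x) x\<bar> \<le> \<eta> * (norm x)\<^sup>2" for x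
  proof -
    have "\<bar>inner (e x) x\<bar> \<le> norm (e x) * norm x" by (rule Cauchy_Schwarz_ineq2)
    also have "\<dots> \<le> (\<eta> * norm x) * norm x"
      using b(6) by (intro mult_right_mono order_trans[OF norm_blinfun]) (auto simp: e_def)
    finally show ?thesis by (simp add: power2_eq_square)
  qed
  have inner_eq: "inner (x - S x) x = \<delta> * (norm x)\<^sup>2 - inner (b x) x + inner (e x) x" for x
    unfolding Sx by (simp add: inner_add_left inner_diff_left power2_norm_eq_inner)
  have upper: "inner (x - S x) x \<le> (\<delta> + \<eta>) * (norm x)\<^sup>2" if "p x = x" for x
    using p(4)[OF that] e[of x] unfolding inner_eq by (simp add: distrib_right)
  have lower: "(\<delta> - \<eta>) * (norm x)\<^sup>2 \<le> inner (x - S x) x" if "p x = 0" for x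
    using p(5)[OF that] e[of x] unfolding inner_eq by (simp add: left_diff_distrib)
  \<comment> \<open>The off-diagonal corners of \<open>b\<close> and of the identity vanish, so only
    the perturbation \<open>e\<close> is left.\<close>
  have "(id_blinfun - p) o\<^sub>L (S o\<^sub>L p) = - ((id_blinfun - p) o\<^sub>L (e o\<^sub>L p))"
  proof (rule blinfun_eqI)
    fix x
    have "p (b (p x)) = b (p x)" using pp p(3) by (metis blinfun_apply_blinfun_compose)
    then show "((id_blinfun - p) o\<^sub>L (S o\<^sub>L p)) x = (- ((id_blinfun - p) o\<^sub>L (e o\<^sub>L p))) x"
      by (simp add: e_def blinfun.bilinear_simps pp)
  qed
  also have "norm \<dots> \<le> 1 * (\<eta> * 1)"
    unfolding norm_minus_cancel
    by (intro order_trans[OF norm_blinfun_compose] mult_mono)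
       (use b(6) assms is_projection_norm_le[OF p(2)] is_projection_norm_le[OF is_projection_compl[OF p(2)]]
         in \<open>auto simp: e_def\<close>)
  finally have corner: "norm ((id_blinfun - p) o\<^sub>L (S o\<^sub>L p)) \<le> \<eta>" by simp
  \<comment> \<open>\<open>p S p\<close> is invertible in the corner of \<open>p\<close>, so \<open>p\<close> lies in every ideal that contains \<open>S\<close>.\<close>
  have "p \<in> A"
  proof -
    define u where "u = p o\<^sub>L ((id_blinfun - S) o\<^sub>L p)"
    have "norm u \<le> \<delta> + \<eta>"
    proof (rule self_adjoint_norm_le)
      show "self_adjoint u"
        using is_adjoint_compose[OF _ is_adjoint_compose[OF is_adjoint_diff[OF self_adjoint_id S(2)]], of p p p p] p(2)
        by (simp add: u_def is_projection_def blinfun_compose_assoc)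
      fix x
      have eq: "inner (u x) x = inner (p x - S (p x)) (p x)"
        by (simp add: u_def blinfun.diff_left is_projection_inner[OF p(2)])
      have "0 \<le> inner (u x) x" unfolding eq by (rule order_trans[OF _ norm_defect_sq_le]) simp
      moreover have "inner (u x) x \<le> (\<delta> + \<eta>) * (norm (p x))\<^sup>2" unfolding eq by (rule upper) (rule pp)
      moreover have "(\<delta> + \<eta>) * (norm (p x))\<^sup>2 \<le> (\<delta> + \<eta>) * (norm x)\<^sup>2"
        using assms is_projection_norm_apply_le[OF p(2)] by (intro mult_left_mono power_mono) auto
      ultimately show "\<bar>inner (u x) x\<bar> \<le> (\<delta> + \<eta>) * (norm x)\<^sup>2" by linarith
    qed (use assms in simp)
    then have nu: "norm u < 1" using assms by simp
    note I = closed_unital_algebraD[OF closed_unital_algebra_idealizer[OF A]]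
      closed_unital_algebra_diff[OF closed_unital_algebra_idealizer[OF A]]
    have "u \<in> idealizer A"
      unfolding u_def using cstar_subset_idealizer[OF A] S(1) by (intro I(4) I(6) I(2) p(1)) auto
    \<comment> \<open>The inversion takes place in the idealizer, as \<open>p\<close> is not yet
      known to lie in \<open>A\<close>.\<close>
    then obtain g where g: "g \<in> idealizer A" "g = p + (g o\<^sub>L u)"
      using neumann_right[OF I(1) p(1) _ nu] I(3)[OF p(1) I(4)] by blast
    have up: "u = p - (p o\<^sub>L (S o\<^sub>L p))" "u o\<^sub>L p = u"
      using p(2) by (simp_all add: u_def blinfun_compose_simps is_projection_def)
    have "g o\<^sub>L p = (p + (g o\<^sub>L u)) o\<^sub>L p" by (simp flip: g(2))
    also have "\<dots> = p + (g o\<^sub>L u)" using p(2) by (simp add: blinfun_compose_simps up(2) is_projection_def)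
    finally have gp: "g o\<^sub>L p = g" by (simp flip: g(2))
    have "g o\<^sub>L u = g - (g o\<^sub>L (p o\<^sub>L (S o\<^sub>L p)))" unfolding up(1) by (simp add: blinfun_compose_simps gp)
    moreover have "g o\<^sub>L u = g - p" using g(2) by (metis add_diff_cancel_left')
    ultimately have "g o\<^sub>L (p o\<^sub>L (S o\<^sub>L p)) = p" by simp
    moreover have "g o\<^sub>L (p o\<^sub>L (S o\<^sub>L p)) \<in> A"
      by (intro idealizerD g p S)
    ultimately show ?thesis by simp
  qed
  then show ?thesis using that p(2) upper lower corner by blast
qed

text \<open>
  The estimate \<open>\<parallel>x - r x\<parallel> \<le> C \<parallel>x - S x\<parallel>\<close> says that the range of \<open>r\<close> contains all approximate
  eigenvectors of \<open>S\<close> for the eigenvalue \<open>1\<close>. To pass it on to a smaller projection, the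
  approximate spectral projection \<open>p\<close> is corrected by a Schur complement: with \<open>q = 1 - p\<close> and \<open>d\<close> the
  inverse of \<open>q (1 - S) q\<close> in the corner of \<open>q\<close>, the operator \<open>p + d q S p\<close> is close to \<open>p\<close> and moves
  every \<open>x\<close> by exactly \<open>d q (1 - S) x\<close>.
\<close>

lemma smaller_projection:
  assumes r: "r \<in> idealizer A" "is_projection r" and C: "0 \<le> C"
    and rC: "\<And>x. norm (x - r x) \<le> C * norm (x - S x)" and "0 < \<epsilon>"
  obtains r' C' where "r' \<in> A" "is_projection r'" "r o\<^sub>L r' = r'"
    "norm ((id_blinfun - S) o\<^sub>L r') \<le> \<epsilon>" "0 \<le> C'" "\<And>x. norm (x - r' x) \<le> C' * norm (x - S x)"
proof -
  \<comment> \<open>\<mu> will bound \<open>norm (X - p)\<close>: 1/4 is what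
    \<open>range_projection\<close> accepts, and 8\<mu> is the final defect, 2\<mu> for
    \<open>X\<close> times 4 for \<open>W\<close>.\<close>
  define \<mu> where "\<mu> = min (1/4) (\<epsilon> / 8)"
  have \<mu>: "0 < \<mu>" "\<mu> \<le> 1/4" "8 * \<mu> \<le> \<epsilon>" using \<open>0 < \<epsilon>\<close> by (auto simp: \<mu>_def)
  \<comment> \<open>\<kappa> will bound the defect on the range of \<open>p\<close>. It is so small
    that \<open>r\<close>, whose error is at most \<open>C\<close> times the defect, moves that
    range by at most \<mu>/2.\<close>
  define \<kappa> where "\<kappa> = \<mu> / (2 * (1 + C))"
  have \<kappa>: "0 < \<kappa>" using \<mu> C by (simp add: \<kappa>_def)
  have "2 * (1 + C) * \<kappa> = \<mu>" using C by (simp add: \<kappa>_def)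
  then have "2 * \<kappa> + 2 * (C * \<kappa>) = \<mu>" by (simp add: algebra_simps)
  moreover have "0 \<le> C * \<kappa>" using C \<kappa> by simp
  ultimately have \<kappa>2: "\<kappa> \<le> \<mu> / 2" "C * \<kappa> \<le> \<mu> / 2" using \<kappa> by linarith+
  define \<delta> where "\<delta> = \<kappa>\<^sup>2 / 2"
  \<comment> \<open>The inverse \<open>d\<close> has norm at most 2/\<delta>, so this choice bounds
    the Schur correction by \<mu>/4.\<close>
  define \<eta> where "\<eta> = \<delta> * (\<mu> / 8)"
  have "\<kappa>\<^sup>2 \<le> (1/8)\<^sup>2" using \<kappa> \<kappa>2 \<mu> by (intro power_mono) auto
  then have \<delta>: "0 < \<delta>" "2 * \<delta> = \<kappa>\<^sup>2" "\<delta> \<le> 1 / 128" using \<kappa> by (simp_all add: \<delta>_def power2_eq_square)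
  have "\<delta> * (\<mu> / 8) \<le> \<delta> * (1 / 2)" using \<delta> \<mu> by (intro mult_left_mono) auto
  then have \<eta>: "0 < \<eta>" "\<eta> \<le> \<delta> / 2" using \<delta> \<mu> by (simp_all add: \<eta>_def)
  obtain p where p: "p \<in> A" "is_projection p"
    "\<And>x. p x = x \<Longrightarrow> inner (x - S x) x \<le> (\<delta> + \<eta>) * (norm x)\<^sup>2"
    "\<And>x. p x = 0 \<Longrightarrow> (\<delta> - \<eta>) * (norm x)\<^sup>2 \<le> inner (x - S x) x"
    "norm ((id_blinfun - p) o\<^sub>L (S o\<^sub>L p)) \<le> \<eta>"
    using approximate_spectral_projection[of \<delta> \<eta>] \<delta> \<eta> by auto
  note pp = is_projection_idem[OF p(2)]
  have defect_p: "norm (p x - S (p x)) \<le> \<kappa> * norm x" for x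
  proof -
    have "(norm (p x - S (p x)))\<^sup>2 \<le> (\<delta> + \<eta>) * (norm (p x))\<^sup>2"
      by (rule order_trans[OF norm_defect_sq_le p(3)[OF pp]])
    also have "\<dots> \<le> \<kappa>\<^sup>2 * (norm x)\<^sup>2"
      using \<delta> \<eta> is_projection_norm_apply_le[OF p(2)] by (intro mult_mono power_mono) auto
    finally have "(norm (p x - S (p x)))\<^sup>2 \<le> (\<kappa> * norm x)\<^sup>2" by (simp add: power_mult_distrib)
    then show ?thesis by (rule power2_le_imp_le) (use \<kappa> in simp)
  qed
  define q where "q = id_blinfun - p"
  have q: "is_projection q" unfolding q_def by (rule is_projection_compl[OF p(2)])
  have qq: "q (q x) = q x" "p (q x) = 0" for x
    by (simp_all add: q_def blinfun.bilinear_simps pp)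
  note I = closed_unital_algebraD[OF closed_unital_algebra_idealizer[OF A]]
    closed_unital_algebra_diff[OF closed_unital_algebra_idealizer[OF A]]
  have AI: "a \<in> idealizer A" if "a \<in> A" for a using cstar_subset_idealizer[OF A] that by blast
  have qI: "q \<in> idealizer A" unfolding q_def by (intro I AI p)
  define u where "u = q o\<^sub>L (S o\<^sub>L q)"
  define \<gamma> where "\<gamma> = \<delta> - \<eta>"
  have \<gamma>: "\<delta> / 2 \<le> \<gamma>" "0 < \<gamma>" "\<gamma> \<le> 1" using \<delta> \<eta> by (auto simp: \<gamma>_def)
  \<comment> \<open>On the range of \<open>q\<close> the form of \<open>S\<close> is at most 1 -
    \<gamma>, so \<open>q - u\<close> is invertible in the corner of \<open>q\<close>, with inverse
    \<open>d\<close>.\<close>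
  have nu: "norm u \<le> 1 - \<gamma>"
  proof (rule self_adjoint_norm_le)
    show "self_adjoint u"
      using is_adjoint_compose[OF _ is_adjoint_compose[OF S(2)], of q q q q] q
      by (simp add: u_def is_projection_def blinfun_compose_assoc)
    fix x
    have eq: "inner (u x) x = inner (S (q x)) (q x)"
      by (simp add: u_def is_projection_inner[OF q])
    have "\<gamma> * (norm (q x))\<^sup>2 \<le> inner (q x - S (q x)) (q x)" unfolding \<gamma>_def by (rule p(4)) (rule qq)
    then have "inner (u x) x \<le> (1 - \<gamma>) * (norm (q x))\<^sup>2"
      unfolding eq by (simp add: inner_diff_left power2_norm_eq_inner algebra_simps)
    also have "\<dots> \<le> (1 - \<gamma>) * (norm x)\<^sup>2"
      using \<gamma> is_projection_norm_apply_le[OF q] by (intro mult_left_mono power_mono) auto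
    finally show "\<bar>inner (u x) x\<bar> \<le> (1 - \<gamma>) * (norm x)\<^sup>2"
      using positive_part[of "q x"] by (simp add: eq)
  qed (use \<gamma> in simp)
  have "u \<in> idealizer A" unfolding u_def by (intro I(4) qI AI S)
  then obtain d where d: "d \<in> idealizer A" "d = q + (d o\<^sub>L u)"
    using neumann_right[OF I(1) qI, of u] I(3)[OF qI I(4)] nu \<gamma> by force
  have d_apply: "d x = q x + d (u x)" for x
    using arg_cong[OF d(2), of "\<lambda>a. a x"] by (simp add: blinfun.add_left)
  have "norm d \<le> norm q + norm (d o\<^sub>L u)" by (subst d(2)) (rule norm_triangle_ineq)
  also have "\<dots> \<le> 1 + norm d * (1 - \<gamma>)"
    by (intro add_mono order_trans[OF norm_blinfun_compose] mult_left_mono nu is_projection_norm_le q) simp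
  finally have nd: "norm d * \<gamma> \<le> 1" by (simp add: algebra_simps)
  have dq: "d (q x) = d x" for x
    using d_apply[of "q x"] d_apply[of x] by (simp add: u_def qq)
  have dqaq: "d (q (q x - S (q x))) = q x" for x
    using d_apply[of x] by (simp add: u_def blinfun.bilinear_simps dq qq)
  define X where "X = r o\<^sub>L ((p + (d o\<^sub>L (q o\<^sub>L (S o\<^sub>L p)))))"
  have X_apply: "X x = r (p x + d (q (S (p x))))" for x
    by (simp add: X_def blinfun.add_left)
  have XA: "X \<in> A"
    unfolding X_def using r(1) d(1) qI p(1) S(1)
    by (intro idealizerD(1) cstar_add[OF A] cstar_compose[OF A]) 
  have Xp: "X o\<^sub>L p = X"
    by (rule blinfun_eqI) (simp add: X_apply pp)
  have ndq: "norm (d o\<^sub>L (q o\<^sub>L (S o\<^sub>L p))) \<le> \<mu> / 4"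
  proof -
    have "norm (d o\<^sub>L (q o\<^sub>L (S o\<^sub>L p))) \<le> norm d * norm (q o\<^sub>L (S o\<^sub>L p))"
      by (rule norm_blinfun_compose)
    also have "\<dots> \<le> norm d * \<eta>"
      using p(5) unfolding q_def by (rule mult_left_mono) simp
    also have "\<dots> = norm d * (\<delta> / 2) * (\<mu> / 4)" by (simp add: \<eta>_def)
    also have "\<dots> \<le> norm d * \<gamma> * (\<mu> / 4)" using \<gamma> \<mu> by (intro mult_right_mono mult_left_mono) auto
    also have "\<dots> \<le> 1 * (\<mu> / 4)" using nd \<mu> by (intro mult_right_mono) auto
    finally show ?thesis by simp
  qed
  have X_close: "norm (X - p) \<le> \<mu>"
  proof (rule norm_blinfun_bound)
    fix x
    \<comment> \<open>Two errors: the Schur correction, and the distance by which \<open>r\<close>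
      moves \<open>p x\<close>.\<close>
    have "X x - p x = r (d (q (S (p x)))) - (p x - r (p x))"
      by (simp add: X_apply blinfun.add_right)
    then have "norm ((X - p) x) \<le> norm (r (d (q (S (p x))))) + norm (p x - r (p x))"
      unfolding blinfun.diff_left by (metis norm_triangle_ineq4)
    also have "\<dots> \<le> (\<mu> / 4) * norm x + (\<mu> / 2) * norm x"
    proof (rule add_mono)
      have "norm (r (d (q (S (p x))))) \<le> norm ((d o\<^sub>L (q o\<^sub>L (S o\<^sub>L p))) x)"
        using is_projection_norm_apply_le[OF r(2)] by simp
      also have "\<dots> \<le> (\<mu> / 4) * norm x"
        by (rule order_trans[OF norm_blinfun]) (intro mult_right_mono ndq norm_ge_zero)
      finally show "norm (r (d (q (S (p x))))) \<le> (\<mu> / 4) * norm x" .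
      have "norm (p x - r (p x)) \<le> C * (\<kappa> * norm x)"
        by (rule order_trans[OF rC]) (intro mult_left_mono defect_p C)
      also have "\<dots> = (C * \<kappa>) * norm x" by simp
      also have "\<dots> \<le> (\<mu> / 2) * norm x" by (rule mult_right_mono[OF \<kappa>2(2)]) simp
      finally show "norm (p x - r (p x)) \<le> (\<mu> / 2) * norm x" .
    qed
    also have "\<dots> \<le> \<mu> * norm x" using mult_nonneg_nonneg[of \<mu> "norm x"] \<mu> by (simp add: algebra_simps)
    finally show "norm ((X - p) x) \<le> \<mu> * norm x" .
  qed (use \<mu> in simp)
  have X_defect: "norm (x - X x) \<le> (C + norm d) * norm (x - S x)" for x
  proof -
    \<comment> \<open>Splitting \<open>S x\<close> along \<open>q\<close> and \<open>p\<close> and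
      applying \<open>dqaq\<close> to the first part gives the identity for the corrected
      operator.\<close>
    have "q x = d (q (x - S x)) + d (q (S (p x)))"
    proof -
      have "S x = S (q x) + S (p x)" by (simp add: q_def blinfun.bilinear_simps)
      then show ?thesis using dqaq[of x] by (simp add: blinfun.bilinear_simps qq)
    qed
    then have "x - (p x + d (q (S (p x)))) = d (q (x - S x))"
      by (simp add: q_def blinfun.diff_left algebra_simps)
    then have rX: "r x - X x = r (d (q (x - S x)))"
      by (simp add: X_apply flip: blinfun.diff_right)
    have "x - X x = (x - r x) + r (d (q (x - S x)))" unfolding rX[symmetric] by simp
    also have "norm \<dots> \<le> C * norm (x - S x) + norm d * norm (x - S x)"
    proof (rule norm_triangle_le[OF add_mono[OF rC]])
      have "norm (r (d (q (x - S x)))) \<le> norm (d (x - S x))"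
        using is_projection_norm_apply_le[OF r(2)] by (simp add: dq)
      also have "\<dots> \<le> norm d * norm (x - S x)" by (rule norm_blinfun)
      finally show "norm (r (d (q (x - S x)))) \<le> norm d * norm (x - S x)" .
    qed
    finally show ?thesis by (simp add: distrib_right)
  qed
  have "norm (X - p) \<le> 1/4" using X_close \<mu> by simp
  from range_projection[OF A XA p(1,2) Xp this] obtain r' W where
    r': "r' \<in> A" "is_projection r'" "r' o\<^sub>L X = X" "r' = X o\<^sub>L W" "norm W \<le> 4" by blast
  show ?thesis
  proof (rule that[OF r'(1,2)])
    have "r o\<^sub>L X = X" by (rule blinfun_eqI) (simp add: X_apply is_projection_idem[OF r(2)])
    then show "r o\<^sub>L r' = r'" unfolding r'(4) by (metis blinfun_compose_assoc)
    \<comment> \<open>Compare \<open>X\<close> with \<open>p\<close>: the defect of \<open>p\<close>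
      is at most \<kappa>, and 1 - S is a contraction on the difference.\<close>
    have "norm ((id_blinfun - S) o\<^sub>L X) \<le> 2 * \<mu>"
    proof (rule norm_blinfun_bound)
      fix x
      define z where "z = (X - p) x"
      have "((id_blinfun - S) o\<^sub>L X) x = (p x - S (p x)) + (z - S z)"
        by (simp add: z_def blinfun.bilinear_simps)
      then have "norm (((id_blinfun - S) o\<^sub>L X) x) \<le> norm (p x - S (p x)) + norm (z - S z)"
        by (metis norm_triangle_ineq)
      also have "\<dots> \<le> \<kappa> * norm x + \<mu> * norm x"
      proof (rule add_mono[OF defect_p])
        have "norm (z - S z) \<le> norm z" by (rule norm_defect_le)
        also have "\<dots> \<le> \<mu> * norm x"
          unfolding z_def by (rule order_trans[OF norm_blinfun]) (intro mult_right_mono X_close norm_ge_zero)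
        finally show "norm (z - S z) \<le> \<mu> * norm x" .
      qed
      also have "\<dots> \<le> \<mu> * norm x + \<mu> * norm x"
        using \<kappa>2 \<mu> by (intro add_mono mult_right_mono) auto
      finally show "norm (((id_blinfun - S) o\<^sub>L X) x) \<le> 2 * \<mu> * norm x" by simp
    qed (use \<mu> in simp)
    then have "norm ((id_blinfun - S) o\<^sub>L X) * norm W \<le> 2 * \<mu> * 4"
      using r'(5) \<mu>(1) by (intro mult_mono) auto
    then have "norm (((id_blinfun - S) o\<^sub>L X) o\<^sub>L W) \<le> 2 * \<mu> * 4"
      using norm_blinfun_compose order_trans by blast
    then show "norm ((id_blinfun - S) o\<^sub>L r') \<le> \<epsilon>"
      using \<mu>(3) unfolding r'(4) by (simp add: blinfun_compose_assoc)
    show "0 \<le> C + norm d" using C by simp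
    fix x
    have "r' (X x) = X x" using r'(3) by (metis blinfun_apply_blinfun_compose)
    \<comment> \<open>Since \<open>r'\<close> fixes the range of \<open>X\<close>, the estimate for
      \<open>X\<close> carries over with the same constant.\<close>
    then have "x - r' x = (id_blinfun - r') (x - X x)" by (simp add: blinfun.bilinear_simps)
    then have "norm (x - r' x) \<le> norm (x - X x)"
      using is_projection_norm_apply_le[OF is_projection_compl[OF r'(2)]] by metis
    then show "norm (x - r' x) \<le> (C + norm d) * norm (x - S x)" using X_defect[of x] by linarith
  qed
qed

end

section \<open>Products of projections\<close>

lemma projections_inner: "projections inner A = {p \<in> A. is_projection p}"
  by (auto simp: projections_def is_projection_def)

lemma proj_le_iff:
  assumes "is_projection p" "is_projection q"
  shows "proj_le p q \<longleftrightarrow> q o\<^sub>L p = p"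
  using assms is_adjoint_unique[OF is_adjoint_compose[of p p q q], of p] is_projection_compose_commute[of q p]
  by (auto simp: proj_le_def is_projection_def)

lemma is_projection_norm_eqD:
  assumes p: "is_projection p" and "norm (p x) = norm x"
  shows "p x = x"
proof -
  have "inner (p x) x = (norm (p x))\<^sup>2"
    using p by (metis is_projection_idem is_projection_inner power2_norm_eq_inner)
  then have "(norm (x - p x))\<^sup>2 = (norm x)\<^sup>2 - (norm (p x))\<^sup>2"
    by (simp add: power2_norm_eq_inner inner_diff_left inner_diff_right inner_commute)
  then show ?thesis using assms(2) by simp
qed

lemma op_prod_in:
  assumes "cstar_algebra scaleR inner A"
  shows "\<forall>k\<le>n. p k \<in> A \<Longrightarrow> op_prod p n \<in> A"
  by (induction n) (auto intro: cstar_compose[OF assms])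

lemma op_prod_fixed: "\<forall>k\<le>n. blinfun_apply (p k) x = x \<Longrightarrow> op_prod p n x = x"
  by (induction n) auto

lemma norm_op_prod_le: "\<forall>k\<le>n. is_projection (p k) \<Longrightarrow> norm (op_prod p n x) \<le> norm x"
proof (induction n arbitrary: x)
  case (Suc n)
  then have "norm (op_prod p n (p (Suc n) x)) \<le> norm (p (Suc n) x)" by simp
  also have "\<dots> \<le> norm x" using Suc.prems by (intro is_projection_norm_apply_le) auto
  finally show ?case by simp
qed (auto intro: is_projection_norm_apply_le)

text \<open>Every factor is a contraction, so none may shorten the vector, and a projection that
  preserves the length of a vector fixes it. The induction peels off the factor that acts
  first.\<close>

lemma op_prod_isometric:
  "\<forall>k\<le>n. is_projection (p k) \<Longrightarrow> norm (op_prod p n x) = norm x \<Longrightarrow> k \<le> n \<Longrightarrow> blinfun_apply (p k) x = x"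
proof (induction n arbitrary: x k)
  case 0
  then show ?case by (auto intro: is_projection_norm_eqD)
next
  case (Suc n)
  have "norm x \<le> norm (p (Suc n) x)"
    using Suc.prems(1,2) norm_op_prod_le[of n p "p (Suc n) x"] by simp
  moreover have "norm (p (Suc n) x) \<le> norm x" using Suc.prems(1) is_projection_norm_apply_le by blast
  ultimately have "p (Suc n) x = x" using Suc.prems(1) by (intro is_projection_norm_eqD) auto
  moreover from this have "k \<le> n \<Longrightarrow> p k x = x" using Suc.IH[of x k] Suc.prems by simp
  ultimately show ?case using Suc.prems(3) le_Suc_eq by metis
qed

text \<open>Passing to T^* T turns the norm of T into a spectral question about an operator between
  0 and 1. The last estimate says that the adjoint is a contraction at \<open>T x\<close>.\<close>

lemma gram_operator:
  assumes "is_adjoint inner T Y" and "norm T \<le> 1"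
  shows "self_adjoint (Y o\<^sub>L T)" and "inner ((Y o\<^sub>L T) x) x = (norm (T x))\<^sup>2"
    and "(norm ((Y o\<^sub>L T) x))\<^sup>2 \<le> inner ((Y o\<^sub>L T) x) x"
proof -
  note YT = is_adjoint_sym[OF assms(1)]
  show "self_adjoint (Y o\<^sub>L T)" by (rule is_adjoint_compose[OF YT assms(1)])
  show eq: "inner ((Y o\<^sub>L T) x) x = (norm (T x))\<^sup>2" for x
    using is_adjointD[OF YT, of "T x" x] by (simp add: power2_norm_eq_inner)
  have "norm (Y (T x)) \<le> 1 * norm (T x)"
    using is_adjoint_norm_eq[OF assms(1)] assms(2)
    by (intro order_trans[OF norm_blinfun] mult_right_mono) auto
  then show "(norm ((Y o\<^sub>L T) x))\<^sup>2 \<le> inner ((Y o\<^sub>L T) x) x"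
    unfolding eq by (simp add: power_mono)
qed

text \<open>The case of greatest lower bound 0, to which the general one is reduced by subtracting
  \<open>R\<close>.\<close>

lemma norm_op_prod_less_1:
  assumes A: "cstar_algebra scaleR inner A" and inv: "dense_invertibles A"
    and sigma: "sigma_closed proj_le 0 (projections inner A)"
    and Ps: "\<forall>k\<le>n. Ps k \<in> projections inner A"
    and glb: "\<And>q. q \<in> projections inner A \<Longrightarrow> \<forall>k\<le>n. proj_le q (Ps k) \<Longrightarrow> q = 0"
  shows "norm (op_prod Ps n) < 1"
proof (rule ccontr)
  assume T1: "\<not> norm (op_prod Ps n) < 1"
  define T where "T = op_prod Ps n"
  have proj: "\<forall>k\<le>n. is_projection (Ps k)" and T: "T \<in> A"
    using Ps op_prod_in[OF A, of n Ps] by (auto simp: projections_inner T_def)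
  have nT: "norm T \<le> 1"
    unfolding T_def by (rule norm_blinfun_bound) (simp_all add: norm_op_prod_le[OF proj])
  obtain Y where Y: "Y \<in> A" "is_adjoint inner T Y" using cstar_adjoint[OF A T] by blast
  define S where "S = Y o\<^sub>L T"
  have S: "S \<in> A" unfolding S_def by (rule cstar_compose[OF A Y(1) T])
  note gram = gram_operator[OF Y(2) nT, folded S_def]
  note smaller = smaller_projection[OF A inv S gram(1,3)]
  have nonzero: "r \<noteq> 0" if "0 \<le> C" and rC: "\<And>x. norm (x - blinfun_apply r x) \<le> C * norm (x - S x)" for r C
  proof
    assume "r = 0"
    \<comment> \<open>With \<open>r = 0\<close> the defect is bounded below, so T^* T stays away
      from 1. The shift by 1 permits division by the constant.\<close>
    define C1 where "C1 = C + 1"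
    have C1: "1 \<le> C1" using that(1) by (simp add: C1_def)
    have "norm T \<le> sqrt (1 - 1 / C1\<^sup>2)"
    proof (rule norm_blinfun_bound)
      fix x
      have "norm x \<le> C * norm (x - S x)" using rC[of x] \<open>r = 0\<close> by simp
      also have "\<dots> \<le> C1 * norm (x - S x)" by (intro mult_right_mono) (simp_all add: C1_def)
      finally have "(norm x)\<^sup>2 \<le> C1\<^sup>2 * (norm (x - S x))\<^sup>2"
        by (metis norm_ge_zero power_mono power_mult_distrib)
      also have "\<dots> \<le> C1\<^sup>2 * inner (x - S x) x"
        by (intro mult_left_mono norm_defect_sq_le_form gram) simp
      also have "\<dots> = C1\<^sup>2 * ((norm x)\<^sup>2 - (norm (T x))\<^sup>2)"
        by (simp add: inner_diff_left gram(2) power2_norm_eq_inner)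
      finally have "(norm (T x))\<^sup>2 \<le> (1 - 1 / C1\<^sup>2) * (norm x)\<^sup>2"
        using C1 by (simp add: field_simps)
      then have "norm (T x) \<le> sqrt ((1 - 1 / C1\<^sup>2) * (norm x)\<^sup>2)" by (rule real_le_rsqrt)
      then show "norm (T x) \<le> sqrt (1 - 1 / C1\<^sup>2) * norm x" by (simp add: real_sqrt_mult)
    qed (use C1 in simp)
    also have "\<dots> < 1" using C1 by simp
    finally show False using T1 by (simp add: T_def)
  qed
  \<comment> \<open>The second component is the constant of the defect estimate. It may change with
    \<open>k\<close>, and it is what keeps every projection non-zero.\<close>
  define P where "P k rC \<longleftrightarrow> fst rC \<in> A \<and> is_projection (fst rC) \<and>
      norm ((id_blinfun - S) o\<^sub>L fst rC) \<le> inverse (real (Suc k)) \<and> 0 \<le> snd rC \<and>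
      (\<forall>x. norm (x - blinfun_apply (fst rC) x) \<le> snd rC * norm (x - S x))" for k :: nat and rC
  have "\<exists>f. \<forall>k. P k (f k) \<and> fst (f k) o\<^sub>L fst (f (Suc k)) = fst (f (Suc k))"
  proof (rule dependent_nat_choice)
    \<comment> \<open>The construction starts from the identity with constant 0, which is why
      \<open>smaller_projection\<close> admits \<open>r\<close> from the idealizer.\<close>
    have "id_blinfun \<in> idealizer A" by (rule closed_unital_algebraD[OF closed_unital_algebra_idealizer[OF A]])
    then obtain r C where "r \<in> A" "is_projection r" "norm ((id_blinfun - S) o\<^sub>L r) \<le> 1" "0 \<le> C"
      "\<And>x. norm (x - r x) \<le> C * norm (x - S x)"
      using smaller[of id_blinfun 0 1] is_projection_id by auto
    then show "\<exists>x. P 0 x" by (intro exI[of _ "(r, C)"]) (simp add: P_def)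
    fix rC k assume rC: "P k rC"
    have "fst rC \<in> idealizer A" using rC cstar_subset_idealizer[OF A] by (auto simp: P_def)
    then obtain r' C' where "r' \<in> A" "is_projection r'" "fst rC o\<^sub>L r' = r'"
      "norm ((id_blinfun - S) o\<^sub>L r') \<le> inverse (real (Suc (Suc k)))" "0 \<le> C'"
      "\<And>x. norm (x - r' x) \<le> C' * norm (x - S x)"
      using smaller[of "fst rC" "snd rC" "inverse (real (Suc (Suc k)))"] rC unfolding P_def by auto
    then show "\<exists>y. P (Suc k) y \<and> fst rC o\<^sub>L fst y = fst y"
      by (intro exI[of _ "(r', C')"]) (simp add: P_def)
  qed
  then obtain f where f: "\<And>k. P k (f k)" "\<And>k. fst (f k) o\<^sub>L fst (f (Suc k)) = fst (f (Suc k))" by blast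
  have "fst (f k) \<in> projections inner A \<and> fst (f k) \<noteq> 0 \<and> proj_le (fst (f (Suc k))) (fst (f k))" for k
    using f(1)[of k] f(1)[of "Suc k"] f(2)[of k] nonzero[of "snd (f k)" "fst (f k)"]
    by (auto simp: P_def projections_inner proj_le_iff)
  then obtain q where q: "q \<in> projections inner A" "q \<noteq> 0" "\<And>k. proj_le q (fst (f k))"
    using sigma[unfolded sigma_closed_def, rule_format, of "\<lambda>k. fst (f k)"] by blast
  have qproj: "is_projection q" using q(1) by (simp add: projections_inner)
  have Sq: "S (q x) = q x" for x
  proof -
    \<comment> \<open>\<open>q x\<close> lies in the range of the k-th projection, where the defect
      of \<open>S\<close> is at most 1/(k+1).\<close>
    have "norm (q x - S (q x)) \<le> inverse (real (Suc k)) * norm (q x)" for k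
    proof -
      have "is_projection (fst (f k))" by (rule f(1)[unfolded P_def, THEN conjunct2, THEN conjunct1])
      then have "fst (f k) o\<^sub>L q = q" using q(3) proj_le_iff[OF qproj] by blast
      then have "fst (f k) (q x) = q x" by (metis blinfun_apply_blinfun_compose)
      then have "q x - S (q x) = ((id_blinfun - S) o\<^sub>L fst (f k)) (q x)"
        by (simp add: blinfun.diff_left)
      moreover have "norm ((id_blinfun - S) o\<^sub>L fst (f k)) \<le> inverse (real (Suc k))"
        by (rule f(1)[unfolded P_def, THEN conjunct2, THEN conjunct2, THEN conjunct1])
      ultimately show ?thesis
        by (simp only:) (rule order_trans[OF norm_blinfun mult_right_mono], simp_all)
    qed
    moreover have "(\<lambda>k. inverse (real (Suc k)) * norm (q x)) \<longlonglongrightarrow> 0"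
      using tendsto_mult_left_zero[OF LIMSEQ_inverse_real_of_nat] .
    ultimately have "norm (q x - S (q x)) \<le> 0" by (intro LIMSEQ_le_const) auto
    then show ?thesis by simp
  qed
  have "Ps k (q x) = q x" if "k \<le> n" for k x
  proof (rule op_prod_isometric[OF proj _ that])
    have "(norm (T (q x)))\<^sup>2 = (norm (q x))\<^sup>2"
      unfolding gram(2)[symmetric] Sq by (simp add: power2_norm_eq_inner)
    then show "norm (op_prod Ps n (q x)) = norm (q x)" by (simp add: T_def)
  qed
  then have "\<forall>k\<le>n. proj_le q (Ps k)"
    using proj proj_le_iff[OF qproj] by (auto intro!: blinfun_eqI)
  with glb q show False by blast
qed

text \<open>As \<open>R\<close> lies below every \<open>Ps k\<close>, the differences
  \<open>Ps k - R\<close> are projections whose product is T - R. A projection of \<open>A\<close>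
  below all of them is orthogonal to \<open>R\<close>, and adding \<open>R\<close> yields a lower
  bound of the \<open>Ps k\<close>.\<close>

lemma norm_op_prod_diff_glb:
  assumes A: "cstar_algebra scaleR inner A" and inv: "dense_invertibles A"
    and sigma: "sigma_closed proj_le 0 (projections inner A)"
    and Ps: "\<forall>k\<le>n. Ps k \<in> projections inner A"
    and glb: "is_glb_in proj_le (projections inner A) (Ps ` {..n}) R"
  shows "norm (op_prod Ps n - R) < 1"
proof -
  have proj: "is_projection (Ps k)" "Ps k \<in> A" if "k \<le> n" for k
    using Ps that by (auto simp: projections_inner)
  have R: "R \<in> A" "is_projection R" using glb by (auto simp: is_glb_in_def projections_inner)
  have RP: "R o\<^sub>L Ps k = R" "Ps k o\<^sub>L R = R" if "k \<le> n" for k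
    using glb that proj_le_iff[OF R(2) proj(1)[OF that]] by (auto simp: is_glb_in_def proj_le_def)
  define Qs where "Qs k = Ps k - R" for k
  have RR: "R o\<^sub>L R = R" using R(2) by (simp add: is_projection_def)
  have Qs: "Qs k \<in> projections inner A" if "k \<le> n" for k
    using proj[OF that] R RP[OF that]
    by (auto simp: projections_inner is_projection_def Qs_def blinfun_compose_simps intro!: cstar_diff[OF A] is_adjoint_diff)
  have TR: "op_prod Ps m o\<^sub>L R = R" if "m \<le> n" for m
    using that by (induction m) (simp_all add: RP blinfun_compose_assoc)
  have prod: "op_prod Qs m = op_prod Ps m - R" if "m \<le> n" for m
    using that
  proof (induction m)
    case (Suc m)
    then show ?case by (simp add: Qs_def blinfun_compose_simps RP TR RR)
  qed (simp add: Qs_def)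
  have "norm (op_prod Qs n) < 1"
  proof (rule norm_op_prod_less_1[OF A inv sigma])
    show "\<forall>k\<le>n. Qs k \<in> projections inner A" using Qs by blast
    fix q assume q: "q \<in> projections inner A" "\<forall>k\<le>n. proj_le q (Qs k)"
    have qQ: "q o\<^sub>L Qs k = q" if "k \<le> n" for k using q that by (simp add: proj_le_def)
    have "q o\<^sub>L R = (q o\<^sub>L Qs 0) o\<^sub>L R" using qQ by simp
    also have "\<dots> = 0" unfolding blinfun_compose_assoc by (simp add: Qs_def blinfun_compose_simps RP RR)
    finally have qR: "q o\<^sub>L R = 0" .
    have qproj: "is_projection q" using q(1) by (simp add: projections_inner)
    have "self_adjoint (0 :: 'a \<Rightarrow>\<^sub>L 'a)" by (simp add: is_adjoint_def)
    then have Rq: "R o\<^sub>L q = 0"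
      using is_adjoint_compose[of q q R R] qproj R(2) qR is_adjoint_unique
      unfolding is_projection_def by metis
    have "q + R \<in> projections inner A"
      using q(1) R qR Rq RR cstar_add[OF A]
      by (auto simp: projections_inner is_projection_def blinfun_compose_simps intro!: is_adjoint_add)
    moreover have "proj_le (q + R) (Ps k)" if "k \<le> n" for k
    proof -
      have "q o\<^sub>L Ps k = q" using qQ[OF that] qR by (simp add: Qs_def blinfun_compose_simps)
      then show ?thesis by (simp add: proj_le_def blinfun_compose_simps RP[OF that])
    qed
    \<comment> \<open>Maximality of \<open>R\<close> gives (q + R) R = q + R; the left side is
      \<open>R\<close> by orthogonality.\<close>
    ultimately have "proj_le (q + R) R" using glb by (auto simp: is_glb_in_def)
    then show "q = 0" by (simp add: proj_le_def blinfun_compose_simps qR RR)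
  qed
  then show ?thesis by (simp add: prod)
qed

section \<open>Strong limits of powers and the projection onto fixed vectors\<close>

text \<open>
  The powers of \<open>S\<close> converge strongly because \<open>\<langle>S\<^sup>k x, x\<rangle>\<close> is decreasing in \<open>k\<close>.
\<close>

lemma fixed_space_projection:
  fixes S :: "'h::{real_inner, complete_space} \<Rightarrow>\<^sub>L 'h"
  assumes sa: "self_adjoint S" and S: "\<And>x. (norm (S x))\<^sup>2 \<le> inner (S x) x"
  obtains P where "is_projection P" "\<And>x. S (P x) = P x" "\<And>x. S x = x \<Longrightarrow> P x = x"
    "\<And>x. (\<lambda>k. (blinfun_apply S ^^ k) x) \<longlonglongrightarrow> P x"
proof -
  define f where "f k = blinfun_apply S ^^ k" for k
  have f0: "f 0 x = x" and f_Suc: "f (Suc k) x = S (f k x)" and f_add: "f (j + k) x = f j (f k x)" for j k x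
    by (simp_all add: f_def funpow_add)
  have f_inner: "inner (f k x) y = inner x (f k y)" for k x y
  proof (induction k arbitrary: x y)
    case (Suc k)
    have "inner (f (Suc k) x) y = inner x (f k (S y))"
      unfolding f_Suc using Suc is_adjointD[OF sa] by metis
    also have "f k (S y) = f (Suc k) y" using f_add[of k "Suc 0" y] by (simp add: f_Suc f0)
    finally show ?case .
  qed (simp add: f0)
  have S_le: "norm (S x) \<le> norm x" for x
  proof -
    have "norm (S x) * norm (S x) \<le> norm (S x) * norm x"
      using S[of x] norm_cauchy_schwarz[of "S x" x] by (simp add: power2_eq_square)
    then show ?thesis by (cases "S x = 0") (simp_all add: mult_le_cancel_left)
  qed
  have f_le: "norm (f k x) \<le> norm x" for k x
    by (induction k) (auto simp: f0 f_Suc intro: order_trans[OF S_le])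
  have conv: "convergent (\<lambda>k. f k x)" for x
  proof -
    define g where "g j = inner (f j x) x" for j
    have g_add: "g (j + k) = inner (f j x) (f k x)" for j k
      by (simp add: g_def f_inner add.commute[of j] f_add)
    have g_even: "g (m + m) = (norm (f m x))\<^sup>2" and g_odd: "g (Suc (m + m)) = inner (S (f m x)) (f m x)" for m
      using g_add[of m m] g_add[of "Suc m" m] by (simp_all add: f_Suc power2_norm_eq_inner)
    \<comment> \<open>With y = S^m x, the values of \<open>g\<close> from 2m to 2m + 2 are the
      squared norm of y, the form of \<open>S\<close> at y, and the squared norm of S y.\<close>
    have g_nonneg: "0 \<le> g j" and g_Suc: "g (Suc j) \<le> g j" for j
    proof -
      define m where "m = j div 2"
      let ?y = "f m x"
      have "inner (S ?y) ?y \<le> norm (S ?y) * norm ?y" by (rule norm_cauchy_schwarz)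
      also have "\<dots> \<le> norm ?y * norm ?y" by (intro mult_right_mono S_le) simp
      finally have y: "inner (S ?y) ?y \<le> (norm ?y)\<^sup>2" by (simp add: power2_eq_square)
      have "0 \<le> inner (S ?y) ?y" using S[of ?y] by (meson order_trans zero_le_power2)
      moreover have "j = m + m \<or> j = Suc (m + m)" unfolding m_def by presburger
      moreover have "g (Suc (Suc (m + m))) = (norm (S ?y))\<^sup>2" using g_even[of "Suc m"] by (simp add: f_Suc)
      ultimately show "0 \<le> g j" "g (Suc j) \<le> g j"
        using y S[of ?y] g_even[of m] g_odd[of m] by auto
    qed
    have "convergent g"
      by (rule decseq_convergent[of g 0]) (use g_nonneg g_Suc in \<open>auto simp: decseq_Suc_iff convergent_def\<close>)
    then have gC: "Cauchy g" by (rule convergent_Cauchy)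
    have "Cauchy (\<lambda>k. f k x)"
    proof (rule CauchyI)
      fix e :: real assume "0 < e"
      then obtain N where N: "\<And>i j. i \<ge> N \<Longrightarrow> j \<ge> N \<Longrightarrow> norm (g i - g j) < e\<^sup>2 / 2"
        using CauchyD[OF gC, of "e\<^sup>2 / 2"] by auto
      have "norm (f j x - f k x) < e" if "j \<ge> N" "k \<ge> N" for j k
      proof -
        \<comment> \<open>By self-adjointness all three terms of the expanded square are values of
          the Cauchy sequence \<open>g\<close>.\<close>
        have "(norm (f j x - f k x))\<^sup>2 = (g (j + j) - g (j + k)) + (g (k + k) - g (j + k))"
          by (simp add: g_add power2_norm_eq_inner inner_diff_left inner_diff_right inner_commute)
        also have "\<dots> < e\<^sup>2"
        proof -
          have "norm (g (j + j) - g (j + k)) < e\<^sup>2 / 2" "norm (g (k + k) - g (j + k)) < e\<^sup>2 / 2"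
            by (rule N; use that in simp)+
          then show ?thesis unfolding real_norm_def by linarith
        qed
        finally show ?thesis using \<open>0 < e\<close> by (simp add: power2_less_imp_less)
      qed
      then show "\<exists>M. \<forall>m\<ge>M. \<forall>n\<ge>M. norm (f m x - f n x) < e" by blast
    qed
    then show ?thesis by (simp add: Cauchy_convergent_iff)
  qed
  define F where "F x = lim (\<lambda>k. f k x)" for x
  have F: "(\<lambda>k. f k x) \<longlonglongrightarrow> F x" for x
    unfolding F_def using conv[of x] by (simp add: convergent_LIMSEQ_iff)
  have f_lin: "f k (x + y) = f k x + f k y" "f k (r *\<^sub>R x) = r *\<^sub>R f k x" for k x y r
    by (induction k) (simp_all add: f0 f_Suc blinfun.bilinear_simps)
  have "bounded_linear F"
  proof (rule bounded_linear_intro)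
    show "F (x + y) = F x + F y" for x y
      by (rule LIMSEQ_unique[OF F]) (simp add: f_lin tendsto_add F)
    show "F (r *\<^sub>R x) = r *\<^sub>R F x" for r x
      by (rule LIMSEQ_unique[OF F]) (simp add: f_lin tendsto_scaleR F)
    show "norm (F x) \<le> norm x * 1" for x
      by (rule LIMSEQ_le_const2[OF tendsto_norm[OF F]]) (simp add: f_le)
  qed
  then have P: "blinfun_apply (Blinfun F) = F" by (rule bounded_linear_Blinfun_apply)
  have SF: "S (F x) = F x" for x
  proof (rule LIMSEQ_unique)
    show "(\<lambda>k. f (Suc k) x) \<longlonglongrightarrow> S (F x)"
      unfolding f_Suc by (intro blinfun.tendsto tendsto_const F)
    show "(\<lambda>k. f (Suc k) x) \<longlonglongrightarrow> F x" by (rule LIMSEQ_Suc[OF F])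
  qed
  have fixed: "F x = x" if "S x = x" for x
  proof (rule LIMSEQ_unique[OF F])
    have "f k x = x" for k by (induction k) (simp_all add: f0 f_Suc that)
    then show "(\<lambda>k. f k x) \<longlonglongrightarrow> x" by simp
  qed
  have "inner (F x) y = inner x (F y)" for x y
    by (rule LIMSEQ_unique[of "\<lambda>k. inner (f k x) y"])
       (intro tendsto_intros F, unfold f_inner, intro tendsto_intros F)
  then have "is_projection (Blinfun F)"
    unfolding is_projection_def is_adjoint_def by (auto simp: P fixed SF intro!: blinfun_eqI)
  then show ?thesis using that[of "Blinfun F"] SF fixed F by (simp add: P f_def)
qed

section \<open>Passage between the given scalar field and the real structure\<close>

context hilbert_space
begin

lemma ip_add_right: "ip x (y + z) = ip x y + ip x z"
  by (metis ip_conjg ip_add_left conjg_add)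

lemma ip_polarization: "ip x y + ip y x = of_real (2 * inner x y)"
proof -
  have "(of_real ((norm (x + y))\<^sup>2) :: 'f) = of_real ((norm x)\<^sup>2) + ip x y + ip y x + of_real ((norm y)\<^sup>2)"
    unfolding ip_self[symmetric] by (simp add: ip_add_left ip_add_right algebra_simps)
  moreover have "(norm (x + y))\<^sup>2 = (norm x)\<^sup>2 + 2 * inner x y + (norm y)\<^sup>2"
    by (simp add: power2_norm_eq_inner inner_add_left inner_add_right inner_commute)
  ultimately show ?thesis by (simp add: algebra_simps)
qed

lemma is_adjoint_innerI:
  assumes "is_adjoint ip a b"
  shows "is_adjoint inner a b"
  unfolding is_adjoint_def
proof (intro allI)
  fix x y
  have "ip (a x) y = ip x (b y)" using assms by (simp add: is_adjoint_def)
  moreover from this have "ip y (a x) = ip (b y) x" by (metis ip_conjg)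
  ultimately have "(of_real (2 * inner (a x) y) :: 'f) = of_real (2 * inner x (b y))"
    by (simp only: flip: ip_polarization)
  then show "inner (a x) y = inner x (b y)" by (simp only: of_real_eq_iff)
qed

text \<open>The real inner product sees only the real part of the discrepancy \<open>w\<close>.
  Linearity of \<open>a\<close> over the scalar field gives the same for every multiple
  \<open>c * w\<close>, and \<open>c = conjg w\<close> yields \<open>w = 0\<close>.\<close>

lemma is_adjoint_ip_iff:
  assumes "a \<in> bounded_ops sc"
  shows "is_adjoint ip a b \<longleftrightarrow> is_adjoint inner a b"
proof
  assume ab: "is_adjoint inner a b"
  show "is_adjoint ip a b"
    unfolding is_adjoint_def
  proof (intro allI)
    fix x y
    define w where "w = ip (a x) y - ip x (b y)"
    have "c * w + conjg (c * w) = 0" for c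
    proof -
      have scaled: "(of_real (2 * inner (sc c u) v) :: 'f) = c * ip u v + conjg (c * ip u v)" for u v
        unfolding ip_polarization[symmetric] ip_conjg[where x = "sc c u"] ip_scale_left ..
      have "a (sc c x) = sc c (a x)" using assms by (simp add: bounded_ops_def)
      then have "inner (sc c (a x)) y = inner (sc c x) (b y)" using is_adjointD[OF ab, of "sc c x" y] by simp
      then have "c * ip (a x) y + conjg (c * ip (a x) y) = c * ip x (b y) + conjg (c * ip x (b y))"
        unfolding scaled[symmetric] by simp
      then show ?thesis by (simp add: w_def right_diff_distrib conjg_diff algebra_simps)
    qed
    then have "conjg w * w + conjg (conjg w * w) = 0" .
    moreover have "conjg w * w = of_real ((norm w)\<^sup>2)"
      using mult_conjg[of w] by (simp only: mult.commute)
    ultimately have "of_real ((norm w)\<^sup>2 + (norm w)\<^sup>2) = (0 :: 'f)"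
      by (simp only: conjg_of_real of_real_add)
    then have "(norm w)\<^sup>2 + (norm w)\<^sup>2 = 0" by (simp only: of_real_eq_0_iff)
    then have "w = 0" by simp
    then show "ip (a x) y = ip x (b y)" by (simp add: w_def)
  qed
qed (rule is_adjoint_innerI)

lemma projections_ip: "A \<subseteq> bounded_ops sc \<Longrightarrow> projections ip A = projections inner A"
  using is_adjoint_ip_iff by (auto simp: projections_def)

lemma op_scale_of_real: "op_scale sc (of_real r) a = r *\<^sub>R a"
  by (rule blinfun_eqI) (simp add: op_scale_apply scale_of_real blinfun.scaleR_left)

lemma cstar_algebra_inner: "cstar_algebra sc ip A \<Longrightarrow> cstar_algebra scaleR inner A"
  unfolding cstar_algebra_def
  by (auto simp: bounded_ops_def blinfun.scaleR_right op_scale_scaleR simp flip: op_scale_of_real)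
    (meson is_adjoint_innerI)

text \<open>If \<open>A\<close> has a unit \<open>e\<close>, invertibility in \<open>A\<close>
  concerns only the corner of \<open>e\<close>, and a multiple of 1 - e completes it. Otherwise the
  unitization contains the identity and already lies in the idealizer.\<close>

lemma real_rank_zero_dense_invertibles:
  assumes A: "cstar_algebra sc ip A" and rr: "real_rank_zero sc ip A"
  shows "dense_invertibles A"
  unfolding dense_invertibles_def
proof (intro ballI allI impI)
  fix S l \<eta>
  assume S: "S \<in> A" "self_adjoint S" and "0 < (l::real)" "0 < (\<eta>::real)"
  note A' = cstar_algebra_inner[OF A]
  note I = closed_unital_algebraD[OF closed_unital_algebra_idealizer[OF A']]
    closed_unital_algebra_diff[OF closed_unital_algebra_idealizer[OF A']]
  have AI: "a \<in> idealizer A" if "a \<in> A" for a using cstar_subset_idealizer[OF A'] that by blast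
  have Abo: "A \<subseteq> bounded_ops sc" using A by (simp add: cstar_algebra_def)
  define B where "B = unitization sc A"
  have dense: "\<exists>b\<in>B. self_adjoint b \<and> invertible_in B b \<and> norm (b - a) \<le> \<eta>"
    if a: "a \<in> B" "self_adjoint a" "a \<in> bounded_ops sc" for a
  proof -
    have "a \<in> closure {a \<in> B. is_adjoint ip a a \<and> invertible_in B a}"
      using rr a is_adjoint_ip_iff[OF a(3)] by (auto simp: real_rank_zero_def Let_def B_def)
    then obtain b where "b \<in> B" "is_adjoint ip b b" "invertible_in B b" "dist b a < \<eta>"
      using \<open>0 < \<eta>\<close> by (auto simp: closure_approachable)
    then show ?thesis using is_adjoint_innerI by (auto simp: dist_norm intro!: bexI[of _ b])
  qed
  show "\<exists>b\<in>idealizer A. \<exists>c\<in>idealizer A. self_adjoint b \<and> b o\<^sub>L c = id_blinfun \<and>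
           c o\<^sub>L b = id_blinfun \<and> norm (b - (S - l *\<^sub>R id_blinfun)) \<le> \<eta>"
  proof (cases "\<exists>e. unit_of A e")
    case True
    then obtain e where e: "e \<in> A" "\<And>a. a \<in> A \<Longrightarrow> e o\<^sub>L a = a" "\<And>a. a \<in> A \<Longrightarrow> a o\<^sub>L e = a"
      by (auto simp: unit_of_def)
    have B: "B = A" using True by (simp add: B_def unitization_def)
    obtain e' where e': "e' \<in> A" "is_adjoint inner e e'" using cstar_adjoint[OF A' e(1)] by blast
    \<comment> \<open>A two-sided unit is self-adjoint: its adjoint equals
      \<open>e o\<^sub>L e'\<close>, which is self-adjoint.\<close>
    have "self_adjoint e'"
      using is_adjoint_compose[OF e'(2) is_adjoint_sym[OF e'(2)]] e(2)[OF e'(1)] by simp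
    then have e_sa: "self_adjoint e"
      using is_adjoint_unique[OF is_adjoint_sym[OF e'(2)]] by metis
    obtain b where b: "b \<in> A" "self_adjoint b" "invertible_in A b" "norm (b - (S - l *\<^sub>R e)) \<le> \<eta>"
      using dense[of "S - l *\<^sub>R e"] S e(1) Abo unfolding B
      by (meson cstar_diff[OF A'] cstar_scaleR[OF A'] is_adjoint_diff is_adjoint_scaleR e_sa subsetD)
    obtain e1 c where c: "unit_of A e1" "c \<in> A" "b o\<^sub>L c = e1" "c o\<^sub>L b = e1"
      using b(3) by (auto simp: invertible_in_def)
    have "e1 = e" using c(1) e unfolding unit_of_def by metis
    \<comment> \<open>On the complement of \<open>e\<close>, S - l is -l, so \<open>b\<close> is
      extended by -l and its inverse by -1/l, leaving the distance unchanged.\<close>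
    define b' where "b' = b - l *\<^sub>R (id_blinfun - e)"
    define c' where "c' = c - (1 / l) *\<^sub>R (id_blinfun - e)"
    have "b' \<in> idealizer A" "c' \<in> idealizer A"
      unfolding b'_def c'_def by (intro I(6) I(5) I(2) AI b(1) c(2) e(1))+
    moreover have "self_adjoint b'"
      unfolding b'_def by (intro is_adjoint_diff is_adjoint_scaleR self_adjoint_id b(2) e_sa)
    moreover have "b' o\<^sub>L c' = id_blinfun" "c' o\<^sub>L b' = id_blinfun"
      using \<open>0 < l\<close> c(3,4) b(1) c(2) e
      by (simp_all add: b'_def c'_def blinfun_compose_simps \<open>e1 = e\<close> scaleR_diff_right)
    moreover have "b' - (S - l *\<^sub>R id_blinfun) = b - (S - l *\<^sub>R e)"
      by (simp add: b'_def scaleR_diff_right)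
    ultimately show ?thesis using b(4) by metis
  next
    case False
    have B: "B = {a + op_scale sc c id_blinfun |a c. a \<in> A}" using False by (simp add: B_def unitization_def)
    \<comment> \<open>Scalars commute with the elements of \<open>A\<close>, so multiplying by them
      on either side stays in \<open>A\<close>.\<close>
    have BI: "B \<subseteq> idealizer A"
    proof
      fix m assume "m \<in> B"
      then obtain a c where m: "a \<in> A" "m = a + op_scale sc c id_blinfun" by (auto simp: B)
      have "op_scale sc c id_blinfun o\<^sub>L d = op_scale sc c d" "d o\<^sub>L op_scale sc c id_blinfun = op_scale sc c d"
        if "d \<in> A" for d
        using that Abo by (auto simp: op_scale_apply bounded_ops_def intro!: blinfun_eqI)
      then show "m \<in> idealizer A"
        using A m(1) by (auto simp: idealizer_def m(2) blinfun_compose_simps cstar_algebra_def)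
    qed
    have "0 \<in> A" using A by (simp add: cstar_algebra_def)
    moreover have "0 + op_scale sc 1 id_blinfun = id_blinfun"
      by (rule blinfun_eqI) (simp add: op_scale_apply)
    ultimately have idB: "id_blinfun \<in> B" unfolding B mem_Collect_eq by metis
    have "S - l *\<^sub>R id_blinfun = S + op_scale sc (of_real (- l)) id_blinfun"
      by (simp only: op_scale_of_real) simp
    then have "S - l *\<^sub>R id_blinfun \<in> B" using S(1) unfolding B by blast
    moreover have "self_adjoint (S - l *\<^sub>R id_blinfun)"
      by (intro is_adjoint_diff is_adjoint_scaleR self_adjoint_id S)
    moreover have "S - l *\<^sub>R id_blinfun \<in> bounded_ops sc"
      using S(1) Abo
      by (auto simp: bounded_ops_def blinfun.bilinear_simps scale_right_diff_distrib scale_scale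
          mult.commute simp flip: scale_of_real)
    ultimately obtain b where b: "b \<in> B" "self_adjoint b" "invertible_in B b"
        "norm (b - (S - l *\<^sub>R id_blinfun)) \<le> \<eta>"
      using dense by blast
    obtain e c where c: "unit_of B e" "c \<in> B" "b o\<^sub>L c = e" "c o\<^sub>L b = e"
      using b(3) by (auto simp: invertible_in_def)
    have "e = id_blinfun" using c(1) idB by (metis unit_of_def compose_id(2))
    then show ?thesis using b c BI by (metis subsetD)
  qed
qed

text \<open>The vectors fixed by T^* T are those fixed by all \<open>Ps k\<close>. The projection
  onto them is a strong limit of powers of T^* T and therefore commutes with the scalars.\<close>

lemma projection_onto_common_fixed_points:
  fixes Ps :: "nat \<Rightarrow> 'h \<Rightarrow>\<^sub>L 'h"
  assumes A: "cstar_algebra sc ip A" and Ps: "\<forall>k\<le>n. Ps k \<in> projections ip A"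
  obtains P where "P \<in> bounded_ops sc" "is_projection P" "\<And>k. k \<le> n \<Longrightarrow> Ps k o\<^sub>L P = P"
    "\<And>x. (\<And>k. k \<le> n \<Longrightarrow> Ps k x = x) \<Longrightarrow> P x = x"
proof -
  note A' = cstar_algebra_inner[OF A]
  have Abo: "A \<subseteq> bounded_ops sc" using A by (simp add: cstar_algebra_def)
  define T where "T = op_prod Ps n"
  have proj: "\<forall>k\<le>n. is_projection (Ps k)" and T: "T \<in> A"
    using Ps op_prod_in[OF A', of n Ps] by (auto simp: projections_ip[OF Abo] projections_inner T_def)
  have nT: "norm T \<le> 1"
    unfolding T_def by (rule norm_blinfun_bound) (simp_all add: norm_op_prod_le[OF proj])
  obtain Y where Y: "Y \<in> A" "is_adjoint inner T Y" using cstar_adjoint[OF A' T] by blast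
  define S where "S = Y o\<^sub>L T"
  note gram = gram_operator[OF Y(2) nT, folded S_def]
  obtain P where P: "is_projection P" "\<And>x. S (P x) = P x" "\<And>x. S x = x \<Longrightarrow> P x = x"
    "\<And>x. (\<lambda>k. (blinfun_apply S ^^ k) x) \<longlonglongrightarrow> P x"
    using fixed_space_projection[OF gram(1,3)] by blast
  show ?thesis
  proof (rule that[OF _ P(1)])
    have S_sc: "S (sc c x) = sc c (S x)" for c x
      using cstar_compose[OF A' Y(1) T] Abo by (auto simp: bounded_ops_def S_def)
    have "P (sc c x) = sc c (P x)" for c x
    proof (rule LIMSEQ_unique[OF P(4)])
      have "(blinfun_apply S ^^ k) (sc c x) = op_scale sc c id_blinfun ((blinfun_apply S ^^ k) x)" for k
        by (induction k) (simp_all add: S_sc op_scale_apply)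
      moreover have "(\<lambda>k. op_scale sc c id_blinfun ((blinfun_apply S ^^ k) x)) \<longlonglongrightarrow> op_scale sc c id_blinfun (P x)"
        by (intro blinfun.tendsto tendsto_const P)
      ultimately show "(\<lambda>k. (blinfun_apply S ^^ k) (sc c x)) \<longlonglongrightarrow> sc c (P x)"
        by (simp add: op_scale_apply)
    qed
    then show "P \<in> bounded_ops sc" by (simp add: bounded_ops_def)
    show "Ps k o\<^sub>L P = P" if "k \<le> n" for k
    proof (rule blinfun_eqI)
      fix x
      have "(norm (T (P x)))\<^sup>2 = (norm (P x))\<^sup>2"
        unfolding gram(2)[symmetric] P(2) by (simp add: power2_norm_eq_inner)
      then have "norm (op_prod Ps n (P x)) = norm (P x)" by (simp add: T_def)
      then show "(Ps k o\<^sub>L P) x = P x" using op_prod_isometric[OF proj _ that] by simp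
    qed
    show "P x = x" if "\<And>k. k \<le> n \<Longrightarrow> Ps k x = x" for x
    proof (rule P(3))
      have "T x = x" using op_prod_fixed[of n Ps x] that by (simp add: T_def)
      \<comment> \<open>The squared defect is at most the difference of the squared lengths of
        \<open>x\<close> and \<open>T x\<close>.\<close>
      then have "(norm (x - S x))\<^sup>2 \<le> 0"
        using norm_defect_sq_le_form[of S x] gram(2,3)
        by (simp add: inner_diff_left gram(2) power2_norm_eq_inner)
      then show "S x = x" by simp
    qed
  qed
qed

text \<open>\<open>proj_meet\<close> is a definite description: existence comes from the projection
  onto the common fixed vectors, uniqueness from antisymmetry of \<open>proj_le\<close> on
  projections.\<close>

lemma proj_meet_fixed_points:
  fixes Ps :: "nat \<Rightarrow> 'h \<Rightarrow>\<^sub>L 'h"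
  assumes A: "cstar_algebra sc ip A" and Ps: "\<forall>k\<le>n. Ps k \<in> projections ip A"
  defines "P \<equiv> proj_meet sc ip (Ps ` {..n})"
  shows "is_projection P" and "k \<le> n \<Longrightarrow> Ps k o\<^sub>L P = P"
proof -
  have Abo: "A \<subseteq> bounded_ops sc" using A by (simp add: cstar_algebra_def)
  have proj: "is_projection (Ps k)" if "k \<le> n" for k
    using Ps that by (auto simp: projections_ip[OF Abo] projections_inner)
  obtain Q where Q: "Q \<in> bounded_ops sc" "is_projection Q" "\<And>k. k \<le> n \<Longrightarrow> Ps k o\<^sub>L Q = Q"
    "\<And>x. (\<And>k. k \<le> n \<Longrightarrow> Ps k x = x) \<Longrightarrow> Q x = x"
    using projection_onto_common_fixed_points[OF A Ps] by blast
  have glb: "is_glb_in proj_le (projections ip (bounded_ops sc)) (Ps ` {..n}) Q"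
    unfolding is_glb_in_def
  proof (intro conjI ballI impI)
    show "Q \<in> projections ip (bounded_ops sc)" using Q by (simp add: projections_ip projections_inner)
    show "proj_le Q p" if "p \<in> Ps ` {..n}" for p using that Q(2,3) proj by (auto simp: proj_le_iff)
    fix l assume l: "l \<in> projections ip (bounded_ops sc)" "\<forall>p\<in>Ps ` {..n}. proj_le l p"
    then have lproj: "is_projection l" by (simp add: projections_ip projections_inner)
    have "Q (l x) = l x" for x
    proof (rule Q(4))
      fix k assume "k \<le> n"
      then have "Ps k o\<^sub>L l = l" using l(2) lproj proj proj_le_iff by blast
      then show "Ps k (l x) = l x" by (metis blinfun_apply_blinfun_compose)
    qed
    then show "proj_le l Q" using lproj Q(2) by (auto simp: proj_le_iff intro!: blinfun_eqI)
  qed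
  have "P = Q"
    unfolding P_def proj_meet_def
  proof (rule the_equality, rule glb)
    fix l assume "is_glb_in proj_le (projections ip (bounded_ops sc)) (Ps ` {..n}) l"
    then have "l \<in> projections ip (bounded_ops sc)" "proj_le l Q" "proj_le Q l"
      using glb by (auto simp: is_glb_in_def)
    then show "l = Q"
      using Q(2) proj_le_iff[of Q l] by (simp add: projections_ip projections_inner proj_le_def)
  qed
  with Q show "is_projection P" "k \<le> n \<Longrightarrow> Ps k o\<^sub>L P = P" by auto
qed

end

section \<open>The two claims over the given scalar field\<close>

theorem theorem4p2:
  fixes sc :: "'f::real_or_complex \<Rightarrow> 'h::{real_inner, complete_space} \<Rightarrow> 'h"
    and ip :: "'h \<Rightarrow> 'h \<Rightarrow> 'f"
    and A :: "('h \<Rightarrow>\<^sub>L 'h) set"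
    and Ps :: "nat \<Rightarrow> 'h \<Rightarrow>\<^sub>L 'h"
    and n :: nat
    and T P :: "'h \<Rightarrow>\<^sub>L 'h"
  assumes "hilbert_space sc ip"
    and "cstar_algebra sc ip A"
    and "\<forall>k\<le>n. Ps k \<in> projections ip A"
    and "T = op_prod Ps n"
    and "P = proj_meet sc ip (Ps ` {..n})"
  shows "(\<forall>R. R \<in> projections ip (bounded_ops sc) \<and> proj_le R P \<and> norm (T - R) < 1 \<longrightarrow> R = P) \<and>
         (real_rank_zero sc ip A \<and> sigma_closed proj_le 0 (projections ip A) \<longrightarrow>
            (\<forall>R. is_glb_in proj_le (projections ip A) (Ps ` {..n}) R \<longrightarrow> norm (T - R) < 1))"
proof -
  interpret hilbert_space sc ip by fact
  have Abo: "A \<subseteq> bounded_ops sc" using assms(2) by (simp add: cstar_algebra_def)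
  note P = proj_meet_fixed_points[OF assms(2,3), folded assms(5)]
  have "R = P" if R: "R \<in> projections ip (bounded_ops sc)" "proj_le R P" and less: "norm (T - R) < 1" for R
  proof (rule blinfun_eqI)
    fix x
    have Rproj: "is_projection R" using R(1) by (simp add: projections_ip projections_inner)
    have PR: "P (R x) = R x" and RP: "R (P x) = R x" for x
      using R(2) proj_le_iff[OF Rproj P(1)] unfolding proj_le_def
      by (metis blinfun_apply_blinfun_compose)+
    \<comment> \<open>T fixes \<open>y\<close> and \<open>R\<close> annihilates it, so T - R fixes
      it too, and a norm below 1 forces \<open>y = 0\<close>.\<close>
    define y where "y = P x - R x"
    have "P y = y"
      by (simp add: y_def blinfun.diff_right PR is_projection_idem[OF P(1)])
    then have "Ps k y = y" if "k \<le> n" for k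
      using P(2)[OF that] by (metis blinfun_apply_blinfun_compose)
    then have "T y = y" using op_prod_fixed[of n Ps y] by (simp add: assms(4))
    moreover have "R y = 0" by (simp add: y_def blinfun.diff_right RP is_projection_idem[OF Rproj])
    ultimately have "norm y \<le> norm (T - R) * norm y"
      using norm_blinfun[of "T - R" y] by (simp add: blinfun.diff_left)
    then have "y = 0"
      using less mult_strict_right_mono[of "norm (T - R)" 1 "norm y"] by (cases "y = 0") auto
    then show "R x = P x" by (simp add: y_def)
  qed
  moreover have "norm (T - R) < 1"
    if "real_rank_zero sc ip A" "sigma_closed proj_le 0 (projections ip A)"
      "is_glb_in proj_le (projections ip A) (Ps ` {..n}) R" for R
    using norm_op_prod_diff_glb[OF cstar_algebra_inner[OF assms(2)]
        real_rank_zero_dense_invertibles[OF assms(2) that(1)]] that(2,3) assms(3)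
    by (simp add: assms(4) projections_ip[OF Abo])
  ultimately show ?thesis by blast
qed

end
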